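(* Let $T$ be a scaling set. The assignments $G\mapsto\mathcal{C}(G,T)$ and $G\mapsto\hat{\mathcal{C}}(G,T)$ give rise to functors on the category of groups with conjugation-invariant (pseudo)norm and Lipschitz homomorphisms between them. Moreover, $\pi_*\colon\mathcal{D}(-,T)\to\mathcal{C}(-,T)$ and $\hat\pi\colon\hat{\mathcal{D}}(-,T)\to\hat{\mathcal{C}}(-,T)$ are natural transformations of functors. In more detail, any Lipschitz homomorphism $\varphi\colon G\to H$ between groups equipped with conjugation-invariant pseudonorms gives rise to (well-defined) Lipschitz homomorphisms $$\mathcal{C}(\varphi)\colon\mathcal{C}(G,T)\to\mathcal{C}(H,T),\quad \mathcal{C}(\varphi)(g)=\varphi\circ g,\qquad \hat{\mathcal{C}}(\varphi)\colon\hat{\mathcal{C}}(G,T)\to\hat{\mathcal{C}}(H,T),\quad\hat{\mathcal{C}}(\varphi)([g])=[\varphi\circ g],$$ such that $\pi_*\circ\mathcal{D}(\varphi)=\mathcal{C}(\varphi)\circ\pi_*$ and $\hat\pi\circ\hat{\mathcal{D}}(\varphi)=\hat{\mathcal{C}}(\varphi)\circ\hat\pi$. Writing $\varphi_*$ for either $\mathcal{C}(\varphi)$ or $\hat{\mathcal{C}}(\varphi)$, one has $\mathrm{id}_*=\mathrm{id}$ and $(\psi\circ\varphi)_*=\psi_*\circ\varphi_*$ for Lipschitz homomorphisms $\varphi\colon G\to H$ and $\psi\colon H\to K$.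
   Context: Norms. A norm on a group $G$ is a function $\|\cdot\|\colon G\to[0,\infty)$ with $\|g\|=0\iff g=1$, $\|g^{-1}\|=\|g\|$ and $\|gh\|\le\|g\|+\|h\|$; for a pseudonorm one only requires $\|1\|=0$ instead of the first condition. It is conjugation-invariant if $\|hgh^{-1}\|=\|g\|$ for all $g,h$. It induces the bi-invariant (pseudo)metric $d(g,h)=\|g^{-1}h\|$; all metric notions refer to it. A homomorphism $\varphi$ is Lipschitz if there is $C\ge0$ with $\|\varphi(g)\|\le C\|g\|$ for all $g$. The groups $F_{\mathbb{R}}(G)$ and $F(G)$. Let $G$ be a group with a conjugation-invariant (pseudo)norm. $F_{\mathbb{R}}(G)$ is the free product of copies of the additive group $\mathbb{R}$ indexed by the elements $g$ of the set $G$; the element $r$ of the copy indexed by $g$ is written $\overline{g}(r)$. It carries the conjugation-invariant pseudonorm $$\|x\|=\inf\Big\{\sum_{i=1}^n |r_i|\,\|g_i\| : x=\prod_{i=1}^n h_i\,\overline{g_i}(r_i)^{\pm1}h_i^{-1},\ h_i\in F_{\mathbb{R}}(G)\Big\}.$$ $F(G)\le F_{\mathbb{R}}(G)$ is the subgroup generated by the elements $\overline{g}:=\overline{g}(1)$; it is free on $\{\overline{g}: g\in G\}$. For $t\in\mathbb{R}$, $\psi_t\colon F_{\mathbb{R}}(G)\to F_{\mathbb{R}}(G)$ is the homomorphism with $\psi_t(\overline{g}(r))=\overline{g}(tr)$. $\pi\colon F(G)\to G$ is the homomorphism with $\pi(\overline{g})=g$. Directional asymptotic cone. A scaling set is an unbounded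 subset $T\subseteq(0,\infty)$; limits over $t\in T$ are taken as $t\to\infty$. A function $f$ from $T$ to a pseudometric space is Cauchy if for every $\epsilon>0$, $d(f(t),f(t'))<\epsilon$ for all sufficiently large $t,t'\in T$. $\mathcal{D}(G,T)$ is the group (pointwise product) of all functions $w\colon T\to F(G)$ such that $t\mapsto\psi_{1/t}(w(t))\in F_{\mathbb{R}}(G)$ is Cauchy, with pseudonorm $\|w\|=\lim_{t\in T}\|\psi_{1/t}(w(t))\|$; $\hat{\mathcal{D}}(G,T)$ is its quotient by the normal subgroup of elements of pseudonorm $0$, with the induced norm. $\mathcal{C}(G,T)=\{\pi\circ w: w\in\mathcal{D}(G,T)\}$, a group of functions $T\to G$, with pseudonorm $\|g\|=\inf\{\|w\|: w\in\mathcal{D}(G,T),\ \pi\circ w=g\}$. The directional asymptotic cone $\hat{\mathcal{C}}(G,T)$ is the quotient of $\mathcal{C}(G,T)$ by the normal subgroup of elements of pseudonorm $0$, with the induced conjugation-invariant norm. Classes are denoted $[w]$, $[g]$. The epimorphisms $\pi_*\colon\mathcal{D}(G,T)\to\mathcal{C}(G,T)$ and $\hat\pi\colon\hat{\mathcal{D}}(G,T)\to\hat{\mathcal{C}}(G,T)$ are $\pi_*(w)=\pi\circ w$ and $\hat\pi([w])=[\pi\circ w]$. Functoriality of $\mathcal{D}$ and $\hat{\mathcal{D}}$: a Lipschitz homomorphism $\varphi\colon G\to H$ induces $F(\varphi)\colon F(G)\to F(H)$, $\overline{g}\mapsto\overline{\varphi(g)}$, and Lipschitz homomorphisms $\mathcal{D}(\varphi)(w)=F(\varphi)\circ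 w$ and $\hat{\mathcal{D}}(\varphi)([w])=[F(\varphi)\circ w]$. *)

theory Defs
  imports Complex_Main "HOL-Algebra.Product_Groups" "HOL-Algebra.Generated_Groups"
begin

section \<open>Groups with conjugation-invariant (pseudo)norm\<close>

record 'a pgroup = "'a monoid" +
  gnorm :: "'a \<Rightarrow> real"

definition with_norm :: "('a, 'm) monoid_scheme \<Rightarrow> ('a \<Rightarrow> real) \<Rightarrow> 'a pgroup" where
  "with_norm M n = \<lparr>carrier = carrier M, mult = mult M, one = one M, gnorm = n\<rparr>"

locale pseudonormed_group = group G for G :: "'a pgroup" (structure) +
  assumes gnorm_nonneg: "x \<in> carrier G \<Longrightarrow> 0 \<le> gnorm G x"
    and gnorm_one: "gnorm G \<one> = 0"
    and gnorm_inv: "x \<in> carrier G \<Longrightarrow> gnorm G (inv x) = gnorm G x"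
    and gnorm_mult: "\<lbrakk>x \<in> carrier G; y \<in> carrier G\<rbrakk> \<Longrightarrow> gnorm G (x \<otimes> y) \<le> gnorm G x + gnorm G y"
    and gnorm_conj: "\<lbrakk>h \<in> carrier G; x \<in> carrier G\<rbrakk> \<Longrightarrow> gnorm G (h \<otimes> x \<otimes> inv h) = gnorm G x"

locale normed_group = pseudonormed_group +
  assumes gnorm_eq_0_iff: "x \<in> carrier G \<Longrightarrow> gnorm G x = 0 \<longleftrightarrow> x = \<one>"

definition gdist :: "'a pgroup \<Rightarrow> 'a \<Rightarrow> 'a \<Rightarrow> real" where
  "gdist G x y = gnorm G (inv\<^bsub>G\<^esub> x \<otimes>\<^bsub>G\<^esub> y)"

definition lipschitz_hom :: "'a pgroup \<Rightarrow> 'b pgroup \<Rightarrow> ('a \<Rightarrow> 'b) \<Rightarrow> bool" where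
  "lipschitz_hom G H \<phi> \<longleftrightarrow>
     \<phi> \<in> hom G H \<and> (\<exists>C\<ge>0. \<forall>x\<in>carrier G. gnorm H (\<phi> x) \<le> C * gnorm G x)"


subsection \<open>The quotient by the elements of pseudonorm zero\<close>

definition null_sub :: "'a pgroup \<Rightarrow> 'a set" where
  "null_sub G = {x \<in> carrier G. gnorm G x = 0}"

definition cls :: "'a pgroup \<Rightarrow> 'a \<Rightarrow> 'a set" where
  "cls G x = null_sub G #>\<^bsub>G\<^esub> x"

text \<open>The norm of a class, and below the image of a class under an induced map, is the common value
  on all representatives; \<^const>\<open>the_elem\<close> picks it only if it does not depend on the representative.\<close>

definition norm_quot :: "'a pgroup \<Rightarrow> 'a set pgroup" where
  "norm_quot G = with_norm (G Mod null_sub G) (\<lambda>X. the_elem (gnorm G ` X))"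

definition quot_map :: "'b pgroup \<Rightarrow> ('a \<Rightarrow> 'b) \<Rightarrow> 'a set \<Rightarrow> 'b set" where
  "quot_map H f X = the_elem ((\<lambda>x. cls H (f x)) ` X)"


section \<open>Free products\<close>

text \<open>The free product is realised on reduced words: finite sequences of nontrivial letters
  \<open>(i, x)\<close> with \<open>x\<close> in the \<open>i\<close>-th factor, neighbouring letters belonging to different factors.\<close>

definition fp_carrier :: "'i set \<Rightarrow> ('i \<Rightarrow> ('a, 'm) monoid_scheme) \<Rightarrow> ('i \<times> 'a) list set" where
  "fp_carrier I G =
     {w. (\<forall>(i, x) \<in> set w. i \<in> I \<and> x \<in> carrier (G i) \<and> x \<noteq> \<one>\<^bsub>G i\<^esub>) \<and> distinct_adj (map fst w)}"

fun fp_cons :: "('i \<Rightarrow> ('a, 'm) monoid_scheme) \<Rightarrow> 'i \<times> 'a \<Rightarrow> ('i \<times> 'a) list \<Rightarrow> ('i \<times> 'a) list" where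
  "fp_cons G (i, x) [] = (if x = \<one>\<^bsub>G i\<^esub> then [] else [(i, x)])"
| "fp_cons G (i, x) ((j, y) # w) =
     (if x = \<one>\<^bsub>G i\<^esub> then (j, y) # w
      else if i = j then (if x \<otimes>\<^bsub>G i\<^esub> y = \<one>\<^bsub>G i\<^esub> then w else (i, x \<otimes>\<^bsub>G i\<^esub> y) # w)
      else (i, x) # (j, y) # w)"

definition free_product :: "'i set \<Rightarrow> ('i \<Rightarrow> ('a, 'm) monoid_scheme) \<Rightarrow> ('i \<times> 'a) list monoid" where
  "free_product I G = \<lparr>carrier = fp_carrier I G, mult = foldr (fp_cons G), one = []\<rparr>"

definition fp_incl :: "('i \<Rightarrow> ('a, 'm) monoid_scheme) \<Rightarrow> 'i \<Rightarrow> 'a \<Rightarrow> ('i \<times> 'a) list" where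
  "fp_incl G i x = fp_cons G (i, x) []"

text \<open>The homomorphism out of a free product that restricts to \<open>f i\<close> on the \<open>i\<close>-th factor.\<close>

definition fp_lift :: "('b, 'n) monoid_scheme \<Rightarrow> ('i \<Rightarrow> 'a \<Rightarrow> 'b) \<Rightarrow> ('i \<times> 'a) list \<Rightarrow> 'b" where
  "fp_lift H f w = foldr (\<lambda>(i, x) a. f i x \<otimes>\<^bsub>H\<^esub> a) w \<one>\<^bsub>H\<^esub>"

lemma fp_carrier_Nil [simp]: "[] \<in> fp_carrier I G"
  by (simp add: fp_carrier_def)

lemma fp_carrier_Cons:
  "(i, x) # w \<in> fp_carrier I G \<longleftrightarrow>
     i \<in> I \<and> x \<in> carrier (G i) \<and> x \<noteq> \<one>\<^bsub>G i\<^esub> \<and> w \<in> fp_carrier I G \<and> (w = [] \<or> fst (hd w) \<noteq> i)"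
  by (cases w) (auto simp: fp_carrier_def)

context
  fixes I :: "'i set" and G :: "'i \<Rightarrow> ('a, 'm) monoid_scheme"
  assumes grp: "\<And>i. i \<in> I \<Longrightarrow> group (G i)"
begin

lemma fp_cons_closed:
  assumes "i \<in> I" "x \<in> carrier (G i)" "w \<in> fp_carrier I G"
  shows "fp_cons G (i, x) w \<in> fp_carrier I G"
proof -
  interpret group "G i" using grp assms(1) .
  show ?thesis using assms by (cases w) (auto simp: fp_carrier_Cons)
qed

lemma fp_cons_one: "fp_cons G (i, \<one>\<^bsub>G i\<^esub>) w = w"
  by (cases w) auto

lemma fp_cons_nontriv:
  "(i, x) # w \<in> fp_carrier I G \<Longrightarrow> fp_cons G (i, x) w = (i, x) # w"
  by (cases w) (auto simp: fp_carrier_Cons)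

lemma fp_cons_cons:
  assumes "i \<in> I" "x \<in> carrier (G i)" "y \<in> carrier (G i)" "w \<in> fp_carrier I G"
  shows "fp_cons G (i, x) (fp_cons G (i, y) w) = fp_cons G (i, x \<otimes>\<^bsub>G i\<^esub> y) w"
proof -
  interpret group "G i" using grp assms(1) .
  have tail: "fp_cons G (i, u) w' = (i, u) # w'"
    if "u \<noteq> \<one>\<^bsub>G i\<^esub>" "w' = [] \<or> fst (hd w') \<noteq> i" for u w'
    using that by (cases w') auto
  consider "w = [] \<or> fst (hd w) \<noteq> i" | z v where "w = (i, z) # v"
    by (metis fst_conv list.exhaust_sel prod.collapse)
  then show ?thesis
  proof cases
    case 1
    then show ?thesis
      using assms by (cases "y = \<one>\<^bsub>G i\<^esub>"; cases "x = \<one>\<^bsub>G i\<^esub>") (auto simp: tail fp_cons_one)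
  next
    case 2
    then have v: "z \<in> carrier (G i)" "z \<noteq> \<one>\<^bsub>G i\<^esub>" "v = [] \<or> fst (hd v) \<noteq> i"
      using assms by (auto simp: fp_carrier_Cons)
    show ?thesis
    proof (cases "y \<otimes>\<^bsub>G i\<^esub> z = \<one>\<^bsub>G i\<^esub>")
      case True
      then have eq: "(x \<otimes>\<^bsub>G i\<^esub> y) \<otimes>\<^bsub>G i\<^esub> z = x"
        using assms v by (simp add: m_assoc)
      have y: "y \<noteq> \<one>\<^bsub>G i\<^esub>" using True v by auto
      show ?thesis
      proof (cases "x = \<one>\<^bsub>G i\<^esub>")
        case True
        then show ?thesis using assms by (simp add: fp_cons_one)
      next
        case False
        have "x \<otimes>\<^bsub>G i\<^esub> y = \<one>\<^bsub>G i\<^esub> \<Longrightarrow> z = x" using eq v by simp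
        then show ?thesis
          using True y eq False v assms 2 by (simp add: tail)
      qed
    next
      case False
      have "x \<otimes>\<^bsub>G i\<^esub> (y \<otimes>\<^bsub>G i\<^esub> z) = z" if "x \<otimes>\<^bsub>G i\<^esub> y = \<one>\<^bsub>G i\<^esub>"
        using that assms v by (simp add: m_assoc [symmetric])
      then show ?thesis
        using False assms v 2
        by (auto simp: m_assoc fp_cons_one)
    qed
  qed
qed

lemma fp_mult_closed:
  "v \<in> fp_carrier I G \<Longrightarrow> w \<in> fp_carrier I G \<Longrightarrow> foldr (fp_cons G) v w \<in> fp_carrier I G"
  by (induction v) (auto simp: fp_carrier_Cons intro: fp_cons_closed)

lemma fp_mult_cons:
  assumes "i \<in> I" "x \<in> carrier (G i)" "v \<in> fp_carrier I G" "w \<in> fp_carrier I G"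
  shows "foldr (fp_cons G) (fp_cons G (i, x) v) w = fp_cons G (i, x) (foldr (fp_cons G) v w)"
proof (cases v)
  case Nil
  then show ?thesis by (simp add: fp_cons_one)
next
  case (Cons a u)
  obtain j y where a: "a = (j, y)" by (cases a)
  have v: "j \<in> I" "y \<in> carrier (G j)" "u \<in> fp_carrier I G"
    using assms(3) by (auto simp: Cons a fp_carrier_Cons)
  have "fp_cons G (i, x) (fp_cons G (i, y) (foldr (fp_cons G) u w))
        = fp_cons G (i, x \<otimes>\<^bsub>G i\<^esub> y) (foldr (fp_cons G) u w)" if "i = j"
    using fp_cons_cons that v assms fp_mult_closed by metis
  then show ?thesis by (auto simp: Cons a fp_cons_one)
qed

lemma fp_mult_assoc:
  assumes "u \<in> fp_carrier I G" "v \<in> fp_carrier I G" "w \<in> fp_carrier I G"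
  shows "foldr (fp_cons G) (foldr (fp_cons G) u v) w = foldr (fp_cons G) u (foldr (fp_cons G) v w)"
  using assms(1)
proof (induction u)
  case (Cons a u)
  then show ?case
    using assms by (cases a) (auto simp: fp_carrier_Cons fp_mult_cons fp_mult_closed)
qed simp

lemma fp_left_inverse:
  "w \<in> fp_carrier I G \<Longrightarrow> \<exists>v \<in> fp_carrier I G. foldr (fp_cons G) v w = []"
proof (induction w)
  case (Cons a w)
  obtain i x where a: "a = (i, x)" by (cases a)
  have w: "i \<in> I" "x \<in> carrier (G i)" "x \<noteq> \<one>\<^bsub>G i\<^esub>" "w \<in> fp_carrier I G"
    using Cons.prems by (auto simp: a fp_carrier_Cons)
  interpret group "G i" using grp w(1) .
  obtain v where v: "v \<in> fp_carrier I G" "foldr (fp_cons G) v w = []" using Cons.IH w by blast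
  have l: "[(i, inv\<^bsub>G i\<^esub> x)] \<in> fp_carrier I G"
    using w by (simp add: fp_carrier_Cons)
  have "fp_cons G (i, inv\<^bsub>G i\<^esub> x) (a # w) = w"
    using w by (simp add: a)
  then have "foldr (fp_cons G) (foldr (fp_cons G) v [(i, inv\<^bsub>G i\<^esub> x)]) (a # w) = []"
    using fp_mult_assoc [OF v(1) l Cons.prems] v(2) by simp
  then show ?case using fp_mult_closed [OF v(1) l] by blast
next
  case Nil
  show ?case by (rule bexI [of _ "[]"]) auto
qed

lemma group_free_product: "group (free_product I G)"
  by (rule groupI)
     (use fp_left_inverse in \<open>auto simp: free_product_def fp_mult_assoc intro: fp_mult_closed\<close>)

lemma fp_incl_hom: "i \<in> I \<Longrightarrow> fp_incl G i \<in> hom (G i) (free_product I G)"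
proof (rule homI)
  fix x y assume i: "i \<in> I" and xy: "x \<in> carrier (G i)" "y \<in> carrier (G i)"
  have "foldr (fp_cons G) (fp_cons G (i, x) []) (fp_cons G (i, y) [])
        = fp_cons G (i, x) (foldr (fp_cons G) [] (fp_cons G (i, y) []))"
    using i xy by (intro fp_mult_cons) (auto intro: fp_cons_closed simp del: fp_cons.simps)
  then show "fp_incl G i (x \<otimes>\<^bsub>G i\<^esub> y) = fp_incl G i x \<otimes>\<^bsub>free_product I G\<^esub> fp_incl G i y"
    using i xy
    by (simp add: fp_incl_def free_product_def fp_cons_cons del: fp_cons.simps)
qed (auto simp: fp_incl_def free_product_def intro: fp_cons_closed simp del: fp_cons.simps)

context
  fixes H :: "('b, 'n) monoid_scheme" and f :: "'i \<Rightarrow> 'a \<Rightarrow> 'b"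
  assumes grpH: "group H" and f: "\<And>i. i \<in> I \<Longrightarrow> f i \<in> hom (G i) H"
begin

lemma fp_lift_closed: "w \<in> fp_carrier I G \<Longrightarrow> fp_lift H f w \<in> carrier H"
proof (induction w)
  interpret group H by (rule grpH)
  case (Cons a w)
  then show ?case
    using f by (cases a) (auto simp: fp_lift_def fp_carrier_Cons hom_def Pi_iff)
qed (use grpH in \<open>simp add: fp_lift_def group.is_monoid monoid.one_closed\<close>)

lemma fp_lift_cons:
  assumes "i \<in> I" "x \<in> carrier (G i)" "w \<in> fp_carrier I G"
  shows "fp_lift H f (fp_cons G (i, x) w) = f i x \<otimes>\<^bsub>H\<^esub> fp_lift H f w"
proof -
  interpret group H by (rule grpH)
  have one: "f i \<one>\<^bsub>G i\<^esub> = \<one>\<^bsub>H\<^esub>"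
    using hom_one [OF f grp grpH] assms by blast
  show ?thesis
  proof (cases w)
    case Nil
    then show ?thesis using assms f one by (auto simp: fp_lift_def hom_def)
  next
    case (Cons a v)
    obtain j y where a: "a = (j, y)" by (cases a)
    have v: "j \<in> I" "y \<in> carrier (G j)" "v \<in> fp_carrier I G"
      using assms by (auto simp: Cons a fp_carrier_Cons)
    have cl: "f i x \<in> carrier H" "f j y \<in> carrier H" "fp_lift H f v \<in> carrier H"
      using assms v f fp_lift_closed by (auto simp: hom_def Pi_iff)
    have m: "i = j \<Longrightarrow> f i (x \<otimes>\<^bsub>G i\<^esub> y) = f i x \<otimes>\<^bsub>H\<^esub> f i y"
      using assms v f by (auto simp: hom_def)
    have C: "fp_lift H f ((k, z) # u) = f k z \<otimes>\<^bsub>H\<^esub> fp_lift H f u" for k z u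
      by (simp add: fp_lift_def)
    show ?thesis
      using cl one m by (auto simp: Cons a C m_assoc [symmetric])
  qed
qed

lemma fp_lift_hom: "fp_lift H f \<in> hom (free_product I G) H"
proof (rule homI)
  interpret group H by (rule grpH)
  fix v w assume "v \<in> carrier (free_product I G)" "w \<in> carrier (free_product I G)"
  then have "v \<in> fp_carrier I G" and w: "w \<in> fp_carrier I G" by (auto simp: free_product_def)
  then have "fp_lift H f (foldr (fp_cons G) v w) = fp_lift H f v \<otimes>\<^bsub>H\<^esub> fp_lift H f w"
  proof (induction v)
    case Nil
    then show ?case using fp_lift_closed by (simp add: fp_lift_def)
  next
    case (Cons a v)
    obtain i x where a: "a = (i, x)" by (cases a)
    have v: "i \<in> I" "x \<in> carrier (G i)" "v \<in> fp_carrier I G"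
      using Cons.prems by (auto simp: a fp_carrier_Cons)
    have C: "fp_lift H f ((i, x) # v) = f i x \<otimes>\<^bsub>H\<^esub> fp_lift H f v"
      by (simp add: fp_lift_def)
    have cl: "f i x \<in> carrier H" using v f by (auto simp: hom_def Pi_iff)
    show ?case
      using Cons v w cl
      by (simp add: a C m_assoc fp_lift_closed fp_lift_cons fp_mult_closed)
  qed
  then show "fp_lift H f (v \<otimes>\<^bsub>free_product I G\<^esub> w) = fp_lift H f v \<otimes>\<^bsub>H\<^esub> fp_lift H f w"
    by (simp add: free_product_def)
qed (auto simp: free_product_def fp_lift_closed)

lemma fp_lift_incl:
  assumes "i \<in> I" "x \<in> carrier (G i)"
  shows "fp_lift H f (fp_incl G i x) = f i x"
proof -
  interpret group H by (rule grpH)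
  have "f i x \<in> carrier H" using assms f by (auto simp: hom_def Pi_iff)
  then show ?thesis
    using fp_lift_cons [OF assms fp_carrier_Nil] by (simp add: fp_incl_def fp_lift_def del: fp_cons.simps)
qed

end

end


section \<open>The groups \<open>F\<^sub>\<real>(G)\<close> and \<open>F(G)\<close>\<close>

definition real_add :: "real monoid" where
  "real_add = \<lparr>carrier = UNIV, mult = (+), one = 0\<rparr>"

definition FR_group :: "'a pgroup \<Rightarrow> ('a \<times> real) list monoid" where
  "FR_group G = free_product (carrier G) (\<lambda>_. real_add)"

definition gbar :: "'a \<Rightarrow> real \<Rightarrow> ('a \<times> real) list" where
  "gbar = fp_incl (\<lambda>_. real_add)"

text \<open>A factorisation is a list of quadruples \<open>(h, g, r, s)\<close>, standing for the conjugate by \<open>h\<close> of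
  \<open>gbar g r\<close> if \<open>s\<close> is true and of its inverse otherwise.\<close>

definition FR_conj_prod ::
  "'a pgroup \<Rightarrow> (('a \<times> real) list \<times> 'a \<times> real \<times> bool) list \<Rightarrow> ('a \<times> real) list" where
  "FR_conj_prod G L =
     foldr (mult (FR_group G))
       (map (\<lambda>(h, g, r, s). h \<otimes>\<^bsub>FR_group G\<^esub> (if s then gbar g r else inv\<^bsub>FR_group G\<^esub> (gbar g r))
                              \<otimes>\<^bsub>FR_group G\<^esub> inv\<^bsub>FR_group G\<^esub> h) L)
       \<one>\<^bsub>FR_group G\<^esub>"

definition FR_norm :: "'a pgroup \<Rightarrow> ('a \<times> real) list \<Rightarrow> real" where
  "FR_norm G x =
     Inf {(\<Sum>(h, g, r, s)\<leftarrow>L. \<bar>r\<bar> * gnorm G g) | L.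
            (\<forall>(h, g, r, s) \<in> set L. h \<in> carrier (FR_group G) \<and> g \<in> carrier G) \<and>
            x = FR_conj_prod G L}"

definition FR :: "'a pgroup \<Rightarrow> ('a \<times> real) list pgroup" where
  "FR G = with_norm (FR_group G) (FR_norm G)"

definition FZ :: "'a pgroup \<Rightarrow> ('a \<times> real) list pgroup" where
  "FZ G = (FR G)\<lparr>carrier := generate (FR G) ((\<lambda>g. gbar g 1) ` carrier G)\<rparr>"

definition psi_map :: "'a pgroup \<Rightarrow> real \<Rightarrow> ('a \<times> real) list \<Rightarrow> ('a \<times> real) list" where
  "psi_map G t = fp_lift (FR G) (\<lambda>g r. gbar g (t * r))"

text \<open>Words in \<^term>\<open>carrier (FZ G)\<close> have integer exponents (lemma \<open>FZ_carrier\<close> below), so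
  the floor only serves to convert them to type \<^typ>\<open>int\<close>.\<close>

definition pi_map :: "'a pgroup \<Rightarrow> ('a \<times> real) list \<Rightarrow> 'a" where
  "pi_map G = fp_lift G (\<lambda>g r. g [^]\<^bsub>G\<^esub> \<lfloor>r\<rfloor>)"

definition F_map :: "'b pgroup \<Rightarrow> ('a \<Rightarrow> 'b) \<Rightarrow> ('a \<times> real) list \<Rightarrow> ('b \<times> real) list" where
  "F_map H \<phi> = fp_lift (FR H) (\<lambda>g r. gbar (\<phi> g) r)"

lemma group_real_add: "group real_add"
proof (rule groupI)
  fix x :: real
  show "\<exists>y\<in>carrier real_add. y \<otimes>\<^bsub>real_add\<^esub> x = \<one>\<^bsub>real_add\<^esub>"
    by (rule bexI [of _ "- x"]) (simp_all add: real_add_def)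
qed (simp_all add: real_add_def)

lemma group_FR_group: "group (FR_group G)"
  unfolding FR_group_def by (rule group_free_product) (rule group_real_add)

lemma FR_simps [simp]:
  "carrier (FR G) = carrier (FR_group G)" "mult (FR G) = mult (FR_group G)"
  "one (FR G) = one (FR_group G)" "gnorm (FR G) = FR_norm G"
  by (simp_all add: FR_def with_norm_def)

lemma group_FR: "group (FR G)"
proof -
  interpret group "FR_group G" by (rule group_FR_group)
  show ?thesis by (rule groupI) (simp_all add: m_assoc l_inv_ex)
qed

lemma gbar_hom: "g \<in> carrier G \<Longrightarrow> gbar g \<in> hom real_add (FR G)"
  using fp_incl_hom [of "carrier G" "\<lambda>_. real_add" g] group_real_add
  by (simp add: gbar_def FR_group_def hom_def)

lemma psi_map_hom: "psi_map G t \<in> hom (FR G) (FR G)"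
proof -
  have "(\<lambda>r. gbar g (t * r)) \<in> hom real_add (FR G)" if "g \<in> carrier G" for g
    using gbar_hom [OF that] by (simp add: hom_def real_add_def Pi_iff distrib_left)
  then have "psi_map G t \<in> hom (FR_group G) (FR G)"
    unfolding psi_map_def FR_group_def
    by (intro fp_lift_hom) (auto intro: group_real_add group_FR)
  then show ?thesis by (simp add: hom_def)
qed

lemma psi_map_gbar:
  assumes "g \<in> carrier G" shows "psi_map G t (gbar g r) = gbar g (t * r)"
proof -
  have "(\<lambda>r. gbar g (t * r)) \<in> hom real_add (FR G)" if "g \<in> carrier G" for g
    using gbar_hom [OF that] by (simp add: hom_def real_add_def Pi_iff distrib_left)
  then have "fp_lift (FR G) (\<lambda>g r. gbar g (t * r)) (fp_incl (\<lambda>_. real_add) g r) = gbar g (t * r)"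
    by (rule fp_lift_incl [where I = "carrier G", OF group_real_add group_FR _ assms])
       (simp_all add: real_add_def)
  then show ?thesis by (simp add: psi_map_def gbar_def)
qed

context
  fixes G :: "'a pgroup" and H :: "'b pgroup" and \<phi> :: "'a \<Rightarrow> 'b"
  assumes \<phi>: "\<phi> \<in> carrier G \<rightarrow> carrier H"
begin

lemma F_map_hom: "F_map H \<phi> \<in> hom (FR G) (FR H)"
proof -
  have "F_map H \<phi> \<in> hom (FR_group G) (FR H)"
    unfolding F_map_def FR_group_def
    by (intro fp_lift_hom group_real_add group_FR gbar_hom funcset_mem [OF \<phi>])
  then show ?thesis by (simp add: hom_def)
qed

lemma F_map_gbar:
  assumes "g \<in> carrier G" shows "F_map H \<phi> (gbar g r) = gbar (\<phi> g) r"
proof -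
  have "gbar (\<phi> g) \<in> hom real_add (FR H)" if "g \<in> carrier G" for g
    by (intro gbar_hom funcset_mem [OF \<phi>] that)
  then have "fp_lift (FR H) (\<lambda>g. gbar (\<phi> g)) (fp_incl (\<lambda>_. real_add) g r) = gbar (\<phi> g) r"
    by (rule fp_lift_incl [where I = "carrier G", OF group_real_add group_FR _ assms])
       (simp_all add: real_add_def)
  then show ?thesis by (simp add: F_map_def gbar_def)
qed

end

abbreviation (input) int_add :: "real monoid" where
  "int_add \<equiv> real_add\<lparr>carrier := \<int>\<rparr>"

lemma group_int_add: "group int_add"
proof (rule groupI)
  fix x :: real assume "x \<in> carrier int_add"
  then show "\<exists>y\<in>carrier int_add. y \<otimes>\<^bsub>int_add\<^esub> x = \<one>\<^bsub>int_add\<^esub>"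
    by (intro bexI [of _ "- x"]) (simp_all add: real_add_def)
qed (simp_all add: real_add_def)

lemma fp_cons_int_add: "fp_cons (\<lambda>_. int_add) = fp_cons (\<lambda>_. real_add)"
proof (intro ext)
  fix a :: "'i \<times> real" and w
  show "fp_cons (\<lambda>_. int_add) a w = fp_cons (\<lambda>_. real_add) a w"
    by (cases a; cases w) auto
qed

lemma FZ_carrier: "carrier (FZ G) \<subseteq> fp_carrier (carrier G) (\<lambda>_. int_add)"
proof
  interpret R: group "FR G" by (rule group_FR)
  have inv_gbar: "inv\<^bsub>FR G\<^esub> (gbar g 1) = gbar g (-1)" if "g \<in> carrier G" for g
  proof (rule R.inv_equality)
    show "gbar g (-1) \<otimes>\<^bsub>FR G\<^esub> gbar g 1 = \<one>\<^bsub>FR G\<^esub>"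
      by (simp add: gbar_def fp_incl_def real_add_def FR_group_def free_product_def)
  qed (use gbar_hom [OF that] in \<open>auto simp: hom_def real_add_def\<close>)
  have gb: "gbar g r \<in> fp_carrier (carrier G) (\<lambda>_. int_add)" if "g \<in> carrier G" "r \<in> \<int>" for g r
    using that by (auto simp: gbar_def fp_incl_def fp_carrier_def real_add_def)
  fix x assume "x \<in> carrier (FZ G)"
  then have "x \<in> generate (FR G) ((\<lambda>g. gbar g 1) ` carrier G)" by (simp add: FZ_def)
  then show "x \<in> fp_carrier (carrier G) (\<lambda>_. int_add)"
  proof induction
    case (eng u v)
    then have "foldr (fp_cons (\<lambda>_. int_add)) u v \<in> fp_carrier (carrier G) (\<lambda>_. int_add)"
      by (intro fp_mult_closed) (auto intro: group_int_add)
    then show ?case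
      unfolding fp_cons_int_add by (simp add: FR_group_def free_product_def)
  qed (auto simp: FR_group_def free_product_def inv_gbar [unfolded FR_group_def] intro!: gb simp del: FR_simps
      simp: inv_gbar FR_simps(3))
qed

context group
begin

lemma int_pow_floor_hom:
  assumes "g \<in> carrier G" shows "(\<lambda>r. g [^] \<lfloor>r\<rfloor>) \<in> hom int_add G"
  using assms by (auto simp: hom_def real_add_def int_pow_mult elim!: Ints_cases)

end

lemma pi_map_hom:
  assumes "group G" shows "pi_map G \<in> hom (FZ G) G"
proof -
  interpret group G by fact
  have "pi_map G \<in> hom (free_product (carrier G) (\<lambda>_. int_add)) G"
    unfolding pi_map_def by (intro fp_lift_hom) (auto intro: group_int_add assms int_pow_floor_hom)
  then show ?thesis
    using FZ_carrier [of G]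
    by (auto simp: hom_def free_product_def fp_cons_int_add FZ_def FR_group_def Pi_iff subset_iff)
qed

lemma pi_map_gbar:
  assumes "group G" "g \<in> carrier G" shows "pi_map G (gbar g 1) = g"
proof -
  interpret group G by fact
  show ?thesis
    using assms by (simp add: pi_map_def gbar_def fp_incl_def fp_lift_def real_add_def)
qed


section \<open>The directional asymptotic cone\<close>

definition scaling_set :: "real set \<Rightarrow> bool" where
  "scaling_set T \<longleftrightarrow> T \<subseteq> {0<..} \<and> \<not> bdd_above T"

definition Cauchy_along :: "'a pgroup \<Rightarrow> real set \<Rightarrow> (real \<Rightarrow> 'a) \<Rightarrow> bool" where
  "Cauchy_along G T f \<longleftrightarrow>
     (\<forall>\<epsilon>>0. \<exists>N. \<forall>t\<in>T. \<forall>t'\<in>T. N \<le> t \<longrightarrow> N \<le> t' \<longrightarrow> gdist G (f t) (f t') < \<epsilon>)"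

text \<open>Functions on \<open>T\<close> are represented by functions on the reals that are \<^const>\<open>undefined\<close> outside
  of \<open>T\<close>, as in \<^const>\<open>product_group\<close>; accordingly \<^const>\<open>compose\<close> \<open>T\<close> is composition.\<close>

definition D_norm :: "real set \<Rightarrow> 'a pgroup \<Rightarrow> (real \<Rightarrow> ('a \<times> real) list) \<Rightarrow> real" where
  "D_norm T G w = Lim (inf at_top (principal T)) (\<lambda>t. gnorm (FR G) (psi_map G (1 / t) (w t)))"

definition D_grp :: "real set \<Rightarrow> 'a pgroup \<Rightarrow> (real \<Rightarrow> ('a \<times> real) list) pgroup" where
  "D_grp T G = with_norm
     ((product_group T (\<lambda>_. FZ G))
        \<lparr>carrier := {w \<in> T \<rightarrow>\<^sub>E carrier (FZ G). Cauchy_along (FR G) T (\<lambda>t. psi_map G (1 / t) (w t))}\<rparr>)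
     (D_norm T G)"

definition pi_star :: "real set \<Rightarrow> 'a pgroup \<Rightarrow> (real \<Rightarrow> ('a \<times> real) list) \<Rightarrow> real \<Rightarrow> 'a" where
  "pi_star T G w = compose T (pi_map G) w"

definition C_norm :: "real set \<Rightarrow> 'a pgroup \<Rightarrow> (real \<Rightarrow> 'a) \<Rightarrow> real" where
  "C_norm T G g = Inf {gnorm (D_grp T G) w | w. w \<in> carrier (D_grp T G) \<and> pi_star T G w = g}"

definition C_grp :: "real set \<Rightarrow> 'a pgroup \<Rightarrow> (real \<Rightarrow> 'a) pgroup" where
  "C_grp T G = with_norm
     ((product_group T (\<lambda>_. G))\<lparr>carrier := pi_star T G ` carrier (D_grp T G)\<rparr>)
     (C_norm T G)"

definition D_hat :: "real set \<Rightarrow> 'a pgroup \<Rightarrow> (real \<Rightarrow> ('a \<times> real) list) set pgroup" where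
  "D_hat T G = norm_quot (D_grp T G)"

definition C_hat :: "real set \<Rightarrow> 'a pgroup \<Rightarrow> (real \<Rightarrow> 'a) set pgroup" where
  "C_hat T G = norm_quot (C_grp T G)"

definition pi_hat ::
  "real set \<Rightarrow> 'a pgroup \<Rightarrow> (real \<Rightarrow> ('a \<times> real) list) set \<Rightarrow> (real \<Rightarrow> 'a) set" where
  "pi_hat T G = quot_map (C_grp T G) (pi_star T G)"


subsection \<open>Action on homomorphisms \<open>\<phi> : G \<rightarrow> H\<close>\<close>

definition D_map :: "real set \<Rightarrow> 'b pgroup \<Rightarrow> ('a \<Rightarrow> 'b) \<Rightarrow>
    (real \<Rightarrow> ('a \<times> real) list) \<Rightarrow> real \<Rightarrow> ('b \<times> real) list" where
  "D_map T H \<phi> w = compose T (F_map H \<phi>) w"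

definition D_hat_map :: "real set \<Rightarrow> 'b pgroup \<Rightarrow> ('a \<Rightarrow> 'b) \<Rightarrow>
    (real \<Rightarrow> ('a \<times> real) list) set \<Rightarrow> (real \<Rightarrow> ('b \<times> real) list) set" where
  "D_hat_map T H \<phi> = quot_map (D_grp T H) (D_map T H \<phi>)"

definition C_map :: "real set \<Rightarrow> ('a \<Rightarrow> 'b) \<Rightarrow> (real \<Rightarrow> 'a) \<Rightarrow> real \<Rightarrow> 'b" where
  "C_map T \<phi> g = compose T \<phi> g"

definition C_hat_map :: "real set \<Rightarrow> 'b pgroup \<Rightarrow> ('a \<Rightarrow> 'b) \<Rightarrow>
    (real \<Rightarrow> 'a) set \<Rightarrow> (real \<Rightarrow> 'b) set" where
  "C_hat_map T H \<phi> = quot_map (C_grp T H) (C_map T \<phi>)"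

end

theory Submission
  imports Defs
begin

text \<open>Everything reduces to the groups \<open>F\<^sub>\<real>(G)\<close>. Their pseudonorm is the largest
  conjugation-invariant one with \<open>\<parallel>gbar g r\<parallel> \<le> \<bar>r\<bar> \<parallel>g\<parallel>\<close>, so a homomorphism out of \<open>F\<^sub>\<real>(G)\<close> is Lipschitz as
  soon as it satisfies a Lipschitz bound on the letters (\<open>FR_norm_hom_le\<close>). This makes \<open>F(\<phi>)\<close>
  Lipschitz with the constant of \<open>\<phi>\<close>. As homomorphisms out of \<open>F\<^sub>\<real>(G)\<close> and \<open>F(G)\<close> are determined by the
  letters, \<open>F(\<phi>)\<close> commutes with all rescalings \<open>\<psi>\<^sub>t\<close> and is compatible with \<open>\<pi>\<close>, and \<open>F\<close> preserves
  identities and compositions.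

  The groups of the theorem arise from this by three constructions on pseudonormed groups, each of
  which is treated abstractly. The pseudonorm of \<open>\<D>(G,T)\<close> is a limit of pseudonorms pulled back
  along the homomorphisms \<open>w \<mapsto> \<psi>\<^bsub>1/t\<^esub>(w(t))\<close> (\<open>pseudonormed_limit\<close>); the limit exists
  because the pseudonorm is 1-Lipschitz for its own pseudometric and the real numbers are complete.
  Since \<open>F(\<phi>)\<close> commutes with rescaling, it carries Cauchy functions to Cauchy functions and the
  Lipschitz bound survives in the limit. The pseudonorm of \<open>\<C>(G,T)\<close> is pushed forward along
  \<open>\<pi>\<^sub>*\<close> (\<open>image_pseudonorm\<close>), and a Lipschitz map upstairs that is compatible with the projections
  induces one downstairs with the same constant (\<open>lipschitz_hom_between_images\<close>). Finally, the two
  hatted groups are quotients by the elements of pseudonorm zero; a Lipschitz homomorphism sends such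
  elements to such elements and hence descends (\<open>quot_map_cls\<close>).\<close>


section \<open>Pseudonormed groups\<close>

lemma with_norm_simps [simp]:
  "carrier (with_norm M n) = carrier M" "mult (with_norm M n) = mult M"
  "one (with_norm M n) = one M" "gnorm (with_norm M n) = n"
  by (simp_all add: with_norm_def)

lemma inv_with_norm [simp]: "inv\<^bsub>with_norm M n\<^esub> x = inv\<^bsub>M\<^esub> x"
  by (simp add: m_inv_def)

lemma hom_with_norm [simp]:
  "hom (with_norm M n) H = hom M H" "hom L (with_norm M n) = hom L M"
  by (simp_all add: hom_def)

lemma group_with_norm:
  assumes "group M" shows "group (with_norm M n)"
proof -
  interpret group M by fact
  show ?thesis by (rule groupI) (simp_all add: m_assoc l_inv_ex)
qed

text \<open>The inequalities for inverses and conjugates suffice: applied to the inverse element, or to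
  conjugation by the inverse, each of them gives its own converse.\<close>

lemma pseudonormed_with_normI:
  fixes M (structure)
  assumes "group M"
    and nonneg: "\<And>x. x \<in> carrier M \<Longrightarrow> 0 \<le> n x"
    and one: "n \<one> = 0"
    and inv: "\<And>x. x \<in> carrier M \<Longrightarrow> n (inv x) \<le> n x"
    and mult: "\<And>x y. x \<in> carrier M \<Longrightarrow> y \<in> carrier M \<Longrightarrow> n (x \<otimes> y) \<le> n x + n y"
    and conj: "\<And>h x. h \<in> carrier M \<Longrightarrow> x \<in> carrier M \<Longrightarrow> n (h \<otimes> x \<otimes> inv h) \<le> n x"
  shows "pseudonormed_group (with_norm M n)"
proof -
  interpret group M by fact
  have "n (inv x) = n x" if "x \<in> carrier M" for x
    using inv [OF that] inv [of "inv x"] that by simp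
  moreover have "n (h \<otimes> x \<otimes> inv h) = n x" if h: "h \<in> carrier M" and x: "x \<in> carrier M" for h x
  proof -
    have "inv h \<otimes> (h \<otimes> x \<otimes> inv h) \<otimes> inv (inv h) = x"
      using h x by (simp add: inv_solve_left' m_assoc)
    then have "n x \<le> n (h \<otimes> x \<otimes> inv h)"
      using conj [of "inv h" "h \<otimes> x \<otimes> inv h"] h x by simp
    with conj [OF h x] show ?thesis by simp
  qed
  ultimately show ?thesis
    using group_with_norm [OF \<open>group M\<close>] nonneg one mult
    by (simp add: pseudonormed_group_def pseudonormed_group_axioms_def)
qed

lemma lipschitz_hom_comp:
  assumes "lipschitz_hom G H f" "lipschitz_hom H K g"
  shows "lipschitz_hom G K (g \<circ> f)"
proof -
  from assms obtain C D where C: "0 \<le> C" "\<And>x. x \<in> carrier G \<Longrightarrow> gnorm H (f x) \<le> C * gnorm G x"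
    and D: "0 \<le> D" "\<And>y. y \<in> carrier H \<Longrightarrow> gnorm K (g y) \<le> D * gnorm H y"
    and f: "f \<in> hom G H" and g: "g \<in> hom H K"
    by (auto simp: lipschitz_hom_def)
  have "gnorm K (g (f x)) \<le> D * C * gnorm G x" if "x \<in> carrier G" for x
    using D(2) [of "f x"] mult_left_mono [OF C(2) [OF that] D(1)] hom_in_carrier [OF f that] by simp
  with C(1) D(1) hom_compose [OF f g] show ?thesis
    unfolding lipschitz_hom_def by (auto intro!: exI [of _ "D * C"])
qed

context pseudonormed_group
begin

text \<open>Bi-invariance of the pseudometric: \<open>(x y)\<inverse> x' y'\<close> is a conjugate of \<open>x\<inverse> x'\<close> times \<open>y\<inverse> y'\<close>.\<close>

lemma gdist_mult_le:
  assumes "x \<in> carrier G" "y \<in> carrier G" "x' \<in> carrier G" "y' \<in> carrier G"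
  shows "gdist G (x \<otimes> y) (x' \<otimes> y') \<le> gdist G x x' + gdist G y y'"
proof -
  let ?a = "inv x \<otimes> x'"
  have "inv (x \<otimes> y) \<otimes> (x' \<otimes> y') = (inv y \<otimes> ?a \<otimes> inv (inv y)) \<otimes> (inv y \<otimes> y')"
    using assms by (simp add: inv_mult_group m_assoc) (simp flip: m_assoc)
  then show ?thesis
    using gnorm_mult [of "inv y \<otimes> ?a \<otimes> inv (inv y)" "inv y \<otimes> y'"] gnorm_conj [of "inv y" ?a] assms
    by (simp add: gdist_def)
qed

text \<open>\<open>x y\<inverse>\<close> is conjugate to \<open>y\<inverse> x\<close>.\<close>

lemma gdist_inv_le:
  assumes "x \<in> carrier G" "y \<in> carrier G"
  shows "gdist G (inv x) (inv y) \<le> gdist G x y"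
proof -
  have "inv (inv x) \<otimes> inv y = x \<otimes> inv (inv x \<otimes> y) \<otimes> inv x"
    using assms by (simp add: inv_mult_group m_assoc)
  then show ?thesis
    using gnorm_conj [of x "inv (inv x \<otimes> y)"] gnorm_inv [of "inv x \<otimes> y"] assms
    by (simp add: gdist_def)
qed

lemma gnorm_diff_le:
  assumes "x \<in> carrier G" "y \<in> carrier G"
  shows "\<bar>gnorm G x - gnorm G y\<bar> \<le> gdist G x y"
proof -
  have "x \<otimes> (inv x \<otimes> y) = y" "y \<otimes> inv (inv x \<otimes> y) = x"
    using assms by (simp_all add: inv_mult_group flip: m_assoc)
  then show ?thesis
    using gnorm_mult [of x "inv x \<otimes> y"] gnorm_mult [of y "inv (inv x \<otimes> y)"]
      gnorm_inv [of "inv x \<otimes> y"] assms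
    by (simp add: gdist_def)
qed

end


section \<open>The quotient by the elements of pseudonorm zero\<close>

context pseudonormed_group
begin

lemma null_sub_normal: "null_sub G \<lhd> G"
proof -
  have "subgroup (null_sub G) G"
  proof (rule subgroupI)
    show "x \<otimes> y \<in> null_sub G" if "x \<in> null_sub G" "y \<in> null_sub G" for x y
      using that gnorm_mult [of x y] gnorm_nonneg [of "x \<otimes> y"] by (simp add: null_sub_def)
  qed (auto simp: null_sub_def gnorm_inv gnorm_one)
  then show ?thesis
    by (simp add: normal_inv_iff null_sub_def gnorm_conj)
qed

lemma cls_self: "x \<in> carrier G \<Longrightarrow> x \<in> cls G x"
  unfolding cls_def by (rule rcos_self [OF _ normal_imp_subgroup [OF null_sub_normal]])

lemma cls_eq:
  assumes "y \<in> cls G x" "x \<in> carrier G" shows "cls G y = cls G x"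
  using repr_independence [OF _ _ normal_imp_subgroup [OF null_sub_normal]] assms
  by (simp add: cls_def)

lemma clsE:
  assumes "y \<in> cls G x"
  obtains h where "h \<in> carrier G" "gnorm G h = 0" "y = h \<otimes> x"
  using assms by (auto simp: cls_def r_coset_def null_sub_def)

lemma gnorm_cls:
  assumes "y \<in> cls G x" "x \<in> carrier G" shows "gnorm G y = gnorm G x"
proof -
  obtain h where h: "h \<in> carrier G" "gnorm G h = 0" "y = h \<otimes> x" using assms(1) by (rule clsE)
  then have "inv h \<otimes> y = x" using assms(2) by (simp flip: m_assoc)
  then show ?thesis
    using h assms(2) gnorm_mult [of h x] gnorm_mult [of "inv h" y] by (simp add: gnorm_inv)
qed

lemma carrier_norm_quot: "carrier (norm_quot G) = cls G ` carrier G"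
  by (auto simp: norm_quot_def carrier_FactGroup cls_def)

lemma mult_norm_quot:
  "x \<in> carrier G \<Longrightarrow> y \<in> carrier G \<Longrightarrow> cls G x \<otimes>\<^bsub>norm_quot G\<^esub> cls G y = cls G (x \<otimes> y)"
  by (simp add: norm_quot_def cls_def normal.rcos_sum [OF null_sub_normal])

lemma group_norm_quot: "group (norm_quot G)"
  unfolding norm_quot_def by (intro group_with_norm normal.factorgroup_is_group null_sub_normal)

lemma cls_hom: "cls G \<in> hom G (norm_quot G)"
  by (rule homI) (auto simp: carrier_norm_quot mult_norm_quot)

lemma gnorm_norm_quot:
  assumes "x \<in> carrier G" shows "gnorm (norm_quot G) (cls G x) = gnorm G x"
  unfolding norm_quot_def with_norm_simps
  by (rule the_elem_image_unique) (use cls_self gnorm_cls assms in blast)+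

lemma cls_eq_one_iff:
  assumes "x \<in> carrier G" shows "cls G x = \<one>\<^bsub>norm_quot G\<^esub> \<longleftrightarrow> gnorm G x = 0"
proof -
  have one: "\<one>\<^bsub>norm_quot G\<^esub> = null_sub G" by (simp add: norm_quot_def)
  show ?thesis
    using cls_self [OF assms] assms coset_join2 [OF assms normal_imp_subgroup [OF null_sub_normal]]
    unfolding one by (auto simp: cls_def null_sub_def)
qed

lemma normed_group_norm_quot: "normed_group (norm_quot G)"
proof -
  interpret Q: group "norm_quot G" by (rule group_norm_quot)
  interpret cls: group_hom G "norm_quot G" "cls G"
    by unfold_locales (rule cls_hom)
  show ?thesis
  proof
    fix X assume "X \<in> carrier (norm_quot G)"
    then obtain x where x: "x \<in> carrier G" "X = cls G x" by (auto simp: carrier_norm_quot)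
    show "0 \<le> gnorm (norm_quot G) X" using x by (simp add: gnorm_norm_quot gnorm_nonneg)
    show "gnorm (norm_quot G) (inv\<^bsub>norm_quot G\<^esub> X) = gnorm (norm_quot G) X"
      using x by (simp add: gnorm_norm_quot gnorm_inv flip: cls.hom_inv)
    show "gnorm (norm_quot G) X = 0 \<longleftrightarrow> X = \<one>\<^bsub>norm_quot G\<^esub>"
      using x by (simp add: gnorm_norm_quot cls_eq_one_iff)
    fix Y assume "Y \<in> carrier (norm_quot G)"
    then obtain y where y: "y \<in> carrier G" "Y = cls G y" by (auto simp: carrier_norm_quot)
    show "gnorm (norm_quot G) (X \<otimes>\<^bsub>norm_quot G\<^esub> Y) \<le> gnorm (norm_quot G) X + gnorm (norm_quot G) Y"
      using x y by (simp add: gnorm_norm_quot gnorm_mult flip: cls.hom_mult)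
    show "gnorm (norm_quot G) (Y \<otimes>\<^bsub>norm_quot G\<^esub> X \<otimes>\<^bsub>norm_quot G\<^esub> inv\<^bsub>norm_quot G\<^esub> Y)
          = gnorm (norm_quot G) X"
      using x y by (simp add: gnorm_norm_quot gnorm_conj flip: cls.hom_mult cls.hom_inv)
  next
    show "gnorm (norm_quot G) \<one>\<^bsub>norm_quot G\<^esub> = 0"
      by (simp add: gnorm_norm_quot gnorm_one flip: cls.hom_one)
  qed
qed

end

text \<open>The induced map is well defined because a Lipschitz homomorphism maps elements of
  pseudonorm zero to elements of pseudonorm zero.\<close>

lemma quot_map_cls:
  assumes G: "pseudonormed_group G" and H: "pseudonormed_group H" and f: "lipschitz_hom G H f"
    and x: "x \<in> carrier G"
  shows "quot_map H f (cls G x) = cls H (f x)"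
  unfolding quot_map_def
proof (rule the_elem_image_unique)
  interpret G: pseudonormed_group G by fact
  interpret H: pseudonormed_group H by fact
  show "cls G x \<noteq> {}" using G.cls_self [OF x] by auto
  fix y assume "y \<in> cls G x"
  then obtain h where h: "h \<in> carrier G" "gnorm G h = 0" "y = h \<otimes>\<^bsub>G\<^esub> x" by (rule G.clsE)
  obtain C where "\<And>z. z \<in> carrier G \<Longrightarrow> gnorm H (f z) \<le> C * gnorm G z" and hom: "f \<in> hom G H"
    using f by (auto simp: lipschitz_hom_def)
  then have "gnorm H (f h) = 0"
    using h H.gnorm_nonneg [of "f h"] hom_in_carrier [OF hom h(1)] by fastforce
  then have "f y \<in> cls H (f x)"
    using h x hom_in_carrier [OF hom h(1)] hom_mult [OF hom h(1) x]
    by (auto simp: cls_def r_coset_def null_sub_def)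
  then show "cls H (f y) = cls H (f x)"
    by (rule H.cls_eq [OF _ hom_in_carrier [OF hom x]])
qed

lemma lipschitz_hom_quot_map:
  assumes G: "pseudonormed_group G" and H: "pseudonormed_group H" and f: "lipschitz_hom G H f"
  shows "lipschitz_hom (norm_quot G) (norm_quot H) (quot_map H f)"
proof -
  interpret G: pseudonormed_group G by fact
  interpret H: pseudonormed_group H by fact
  obtain C where C: "0 \<le> C" "\<And>x. x \<in> carrier G \<Longrightarrow> gnorm H (f x) \<le> C * gnorm G x"
    and hom: "f \<in> hom G H"
    using f by (auto simp: lipschitz_hom_def)
  note simps = G.carrier_norm_quot quot_map_cls [OF G H f] hom_in_carrier [OF hom]
    hom_mult [OF hom] G.mult_norm_quot H.mult_norm_quot G.gnorm_norm_quot H.gnorm_norm_quot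
  have "quot_map H f \<in> hom (norm_quot G) (norm_quot H)"
    by (rule homI) (auto simp: simps H.carrier_norm_quot)
  with C show ?thesis
    unfolding lipschitz_hom_def by (auto simp: simps)
qed


section \<open>Pseudonorms pushed forward along homomorphisms and limits of pseudonorms\<close>

text \<open>The image of a homomorphism \<open>p\<close> carries the largest pseudonorm that makes \<open>p\<close> a contraction,
  namely the infimum of the pseudonorm over the fibres of \<open>p\<close>. The group \<open>\<C>(G,T)\<close> is the image of
  \<open>\<D>(G,T)\<close> under \<open>\<pi>\<^sub>*\<close> in this sense.\<close>

locale image_pseudonorm =
  P: pseudonormed_group P + group_hom P M p for P :: "'a pgroup" and M :: "('b, 'm) monoid_scheme" and p
begin

definition image_norm :: "'b \<Rightarrow> real" where
  "image_norm y = Inf {gnorm P x | x. x \<in> carrier P \<and> p x = y}"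

lemma image_norm_le: "x \<in> carrier P \<Longrightarrow> image_norm (p x) \<le> gnorm P x"
  unfolding image_norm_def
  by (rule cInf_lower) (auto intro!: bdd_belowI [of _ 0] P.gnorm_nonneg)

lemma image_norm_greatest:
  assumes "x \<in> carrier P" "\<And>x'. x' \<in> carrier P \<Longrightarrow> p x' = p x \<Longrightarrow> c \<le> gnorm P x'"
  shows "c \<le> image_norm (p x)"
  unfolding image_norm_def using assms by (intro cInf_greatest) auto

lemma pseudonormed_image: "pseudonormed_group (with_norm (M\<lparr>carrier := p ` carrier P\<rparr>) image_norm)"
proof (rule pseudonormed_with_normI)
  have sub: "subgroup (p ` carrier P) M" by (rule img_is_subgroup)
  show "group (M\<lparr>carrier := p ` carrier P\<rparr>)"
    by (rule subgroup.subgroup_is_group [OF sub H.group_axioms])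
  have inv: "inv\<^bsub>M\<lparr>carrier := p ` carrier P\<rparr>\<^esub> (p x) = p (inv\<^bsub>P\<^esub> x)" if "x \<in> carrier P" for x
    using H.m_inv_consistent [OF sub, of "p x"] that by simp
  show "image_norm \<one>\<^bsub>M\<lparr>carrier := p ` carrier P\<rparr>\<^esub> = 0"
    using image_norm_le [of "\<one>\<^bsub>P\<^esub>"] image_norm_greatest [of "\<one>\<^bsub>P\<^esub>" 0] P.gnorm_nonneg
    by (force simp: P.gnorm_one)
  fix y assume "y \<in> carrier (M\<lparr>carrier := p ` carrier P\<rparr>)"
  then obtain x where x: "x \<in> carrier P" "y = p x" by auto
  show "0 \<le> image_norm y"
    unfolding x(2) by (rule image_norm_greatest [OF x(1)]) (rule P.gnorm_nonneg)
  show "image_norm (inv\<^bsub>M\<lparr>carrier := p ` carrier P\<rparr>\<^esub> y) \<le> image_norm y"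
    unfolding x(2) inv [OF x(1)]
  proof (rule image_norm_greatest [OF x(1)])
    fix x' assume "x' \<in> carrier P" "p x' = p x"
    then show "image_norm (p (inv\<^bsub>P\<^esub> x)) \<le> gnorm P x'"
      using image_norm_le [of "inv\<^bsub>P\<^esub> x'"] x by (simp add: P.gnorm_inv)
  qed
  fix z assume "z \<in> carrier (M\<lparr>carrier := p ` carrier P\<rparr>)"
  then obtain u where u: "u \<in> carrier P" "z = p u" by auto
  \<comment> \<open>The infima over the two fibres are taken one after the other.\<close>
  have "image_norm (y \<otimes>\<^bsub>M\<^esub> z) - gnorm P u' \<le> image_norm y" if u': "u' \<in> carrier P" "p u' = p u" for u'
    unfolding x(2)
  proof (rule image_norm_greatest [OF x(1)])
    fix x' assume x': "x' \<in> carrier P" "p x' = p x"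
    then show "image_norm (p x \<otimes>\<^bsub>M\<^esub> z) - gnorm P u' \<le> gnorm P x'"
      using image_norm_le [of "x' \<otimes>\<^bsub>P\<^esub> u'"] P.gnorm_mult [of x' u'] u u' by simp
  qed
  then have "image_norm (y \<otimes>\<^bsub>M\<^esub> z) - image_norm y \<le> gnorm P u'"
    if "u' \<in> carrier P" "p u' = p u" for u'
    using that by (simp add: algebra_simps)
  then have "image_norm (y \<otimes>\<^bsub>M\<^esub> z) - image_norm y \<le> image_norm z"
    unfolding u(2) by (intro image_norm_greatest [OF u(1)])
  then show "image_norm (y \<otimes>\<^bsub>M\<lparr>carrier := p ` carrier P\<rparr>\<^esub> z) \<le> image_norm y + image_norm z"
    by simp
  show "image_norm (z \<otimes>\<^bsub>M\<lparr>carrier := p ` carrier P\<rparr>\<^esub> y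
          \<otimes>\<^bsub>M\<lparr>carrier := p ` carrier P\<rparr>\<^esub> inv\<^bsub>M\<lparr>carrier := p ` carrier P\<rparr>\<^esub> z) \<le> image_norm y"
    unfolding x(2) u(2) inv [OF u(1)]
  proof (rule image_norm_greatest [OF x(1)])
    fix x' assume x': "x' \<in> carrier P" "p x' = p x"
    then show "image_norm (p u \<otimes>\<^bsub>M\<lparr>carrier := p ` carrier P\<rparr>\<^esub> p x
          \<otimes>\<^bsub>M\<lparr>carrier := p ` carrier P\<rparr>\<^esub> p (inv\<^bsub>P\<^esub> u)) \<le> gnorm P x'"
      using image_norm_le [of "u \<otimes>\<^bsub>P\<^esub> x' \<otimes>\<^bsub>P\<^esub> inv\<^bsub>P\<^esub> u"] u by (simp add: P.gnorm_conj)
  qed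
qed

end

text \<open>All conditions on a pseudonorm are weak inequalities, so they pass to pointwise limits.\<close>

lemma pseudonormed_limit:
  fixes M :: "('a, 'm) monoid_scheme"
  assumes P: "pseudonormed_group P" and M: "group M" and F: "F \<noteq> bot"
    and e: "\<And>t. t \<in> T \<Longrightarrow> e t \<in> hom M P" and T: "eventually (\<lambda>t. t \<in> T) F"
    and n: "\<And>x. x \<in> carrier M \<Longrightarrow> ((\<lambda>t. gnorm P (e t x)) \<longlongrightarrow> n x) F"
  shows "pseudonormed_group (with_norm M n)"
proof (rule pseudonormed_with_normI [OF M])
  interpret M: group M by fact
  interpret P: pseudonormed_group P by fact
  have e': "group_hom M P (e t)" if "t \<in> T" for t
    by unfold_locales (rule e [OF that])
  have evI: "eventually Q F" if "\<And>t. t \<in> T \<Longrightarrow> Q t" for Q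
    using T by (rule eventually_mono) (rule that)
  have cl: "e t x \<in> carrier P" if "t \<in> T" "x \<in> carrier M" for t x
    using hom_in_carrier [OF e] that by blast
  show "n \<one>\<^bsub>M\<^esub> = 0"
  proof (rule tendsto_unique [OF F n])
    have "eventually (\<lambda>t. gnorm P (e t \<one>\<^bsub>M\<^esub>) = 0) F"
      by (rule evI) (simp add: group_hom.hom_one [OF e'] P.gnorm_one)
    then show "((\<lambda>t. gnorm P (e t \<one>\<^bsub>M\<^esub>)) \<longlongrightarrow> 0) F" by (rule tendsto_eventually)
  qed simp
  fix x assume x: "x \<in> carrier M"
  show "0 \<le> n x"
    by (rule tendsto_lowerbound [OF n [OF x] evI F]) (simp add: P.gnorm_nonneg cl x)
  show "n (inv\<^bsub>M\<^esub> x) \<le> n x"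
    by (rule tendsto_le [OF F n n evI])
       (simp_all add: x group_hom.hom_inv [OF e'] P.gnorm_inv cl)
  fix y assume y: "y \<in> carrier M"
  show "n (x \<otimes>\<^bsub>M\<^esub> y) \<le> n x + n y"
    by (rule tendsto_le [OF F tendsto_add [OF n n] n evI])
       (simp_all add: x y hom_mult [OF e] P.gnorm_mult cl)
  show "n (x \<otimes>\<^bsub>M\<^esub> y \<otimes>\<^bsub>M\<^esub> inv\<^bsub>M\<^esub> x) \<le> n y"
    by (rule tendsto_le [OF F n n evI])
       (simp_all add: x y hom_mult [OF e] group_hom.hom_inv [OF e'] P.gnorm_conj cl)
qed


lemma (in image_pseudonorm) lipschitz_hom_image:
  "lipschitz_hom P (with_norm (M\<lparr>carrier := p ` carrier P\<rparr>) image_norm) p"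
  unfolding lipschitz_hom_def
  by (auto intro!: homI exI [of _ 1] image_norm_le)

text \<open>As \<open>p\<close> maps onto its image, \<open>k\<close> inherits multiplicativity from \<open>f\<close>. For the
  bound, every preimage \<open>x'\<close> of a point yields the preimage \<open>f x'\<close> of its image under \<open>k\<close>.\<close>

lemma lipschitz_hom_between_images:
  assumes P: "image_pseudonorm P M p" and Q: "image_pseudonorm Q N q"
    and f: "lipschitz_hom P Q f" and k: "\<And>x. x \<in> carrier P \<Longrightarrow> k (p x) = q (f x)"
  shows "lipschitz_hom
    (with_norm (M\<lparr>carrier := p ` carrier P\<rparr>) (image_pseudonorm.image_norm P p))
    (with_norm (N\<lparr>carrier := q ` carrier Q\<rparr>) (image_pseudonorm.image_norm Q q)) k"
proof -
  interpret P: image_pseudonorm P M p by fact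
  interpret Q: image_pseudonorm Q N q by fact
  obtain C where C: "0 \<le> C" "\<And>x. x \<in> carrier P \<Longrightarrow> gnorm Q (f x) \<le> C * gnorm P x"
    and hom: "f \<in> hom P Q"
    using f by (auto simp: lipschitz_hom_def)
  note cl = hom_in_carrier [OF hom]
  have "k \<in> hom (M\<lparr>carrier := p ` carrier P\<rparr>) (N\<lparr>carrier := q ` carrier Q\<rparr>)"
    by (rule homI) (auto simp: k cl hom_mult [OF hom] simp flip: P.hom_mult)
  moreover have "Q.image_norm (k (p x)) \<le> C * P.image_norm (p x)" if x: "x \<in> carrier P" for x
  proof -
    have le: "Q.image_norm (k (p x)) \<le> C * gnorm P x'" if "x' \<in> carrier P" "p x' = p x" for x'
      using Q.image_norm_le [OF cl [OF that(1)]] C(2) [OF that(1)] k [OF that(1)] that(2) by simp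
    \<comment> \<open>The infimum is reached by dividing by \<open>C\<close>, so \<open>C = 0\<close> is treated separately.\<close>
    show ?thesis
    proof (cases "C = 0")
      case True
      then show ?thesis using le [OF x] by simp
    next
      case False
      with C(1) le have "Q.image_norm (k (p x)) / C \<le> P.image_norm (p x)"
        by (intro P.image_norm_greatest [OF x]) (simp add: divide_le_eq mult.commute)
      then show ?thesis using C(1) False by (simp add: divide_le_eq mult.commute)
    qed
  qed
  ultimately show ?thesis
    using C(1) by (auto simp: lipschitz_hom_def intro!: exI [of _ C])
qed


section \<open>The pseudonorm on \<open>F\<^sub>\<real>(G)\<close>\<close>

lemma hom_FR [simp]: "hom (FR G) M = hom (FR_group G) M" "hom M (FR G) = hom M (FR_group G)"
  by (simp_all add: hom_def)

lemma inv_FR [simp]: "inv\<^bsub>FR G\<^esub> x = inv\<^bsub>FR_group G\<^esub> x"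
  by (simp add: FR_def)

lemma gbar_closed: "g \<in> carrier G \<Longrightarrow> gbar g r \<in> carrier (FR_group G)"
  using gbar_hom [of g G] by (auto simp: hom_def real_add_def)

text \<open>A nonempty reduced word is the product of its first letter with the remaining word.\<close>

lemma FR_induct [consumes 1, case_names one mult]:
  assumes "x \<in> carrier (FR_group G)" "P \<one>\<^bsub>FR_group G\<^esub>"
    and "\<And>g r w. g \<in> carrier G \<Longrightarrow> w \<in> carrier (FR_group G) \<Longrightarrow> P w \<Longrightarrow> P (gbar g r \<otimes>\<^bsub>FR_group G\<^esub> w)"
  shows "P x"
  using assms(1)
proof (induction x)
  case Nil
  then show ?case using assms(2) by (simp add: FR_group_def free_product_def)
next
  case (Cons a w)
  obtain g r where a: "a = (g, r)" by (cases a)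
  from Cons.prems have fp: "(g, r) # w \<in> fp_carrier (carrier G) (\<lambda>_. real_add)"
    by (simp add: a FR_group_def free_product_def)
  then have w: "g \<in> carrier G" "r \<noteq> 0" "w \<in> carrier (FR_group G)"
    by (simp_all add: fp_carrier_Cons FR_group_def free_product_def real_add_def)
  have "gbar g r = [(g, r)]"
    using w(2) by (simp add: gbar_def fp_incl_def real_add_def)
  then have "gbar g r \<otimes>\<^bsub>FR_group G\<^esub> w = (g, r) # w"
    using fp_cons_nontriv [OF group_real_add fp] by (simp add: FR_group_def free_product_def)
  then show ?case using assms(3) [of g w r] w Cons.IH by (simp add: a)
qed

lemma FR_hom_eqI:
  assumes "group M" "f \<in> hom (FR_group G) M" "f' \<in> hom (FR_group G) M"
    and "\<And>g r. g \<in> carrier G \<Longrightarrow> f (gbar g r) = f' (gbar g r)"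
    and "x \<in> carrier (FR_group G)"
  shows "f x = f' x"
  using assms(5)
proof (induction rule: FR_induct)
  case one
  show ?case using hom_one [OF _ group_FR_group assms(1)] assms(2,3) by metis
next
  case (mult g r w)
  then show ?case
    using hom_mult [OF assms(2) gbar_closed] hom_mult [OF assms(3) gbar_closed] assms(4) by simp
qed

text \<open>The factorisations over which the infimum in \<^const>\<open>FR_norm\<close> is taken, and the sums of which it is
  the infimum. Concatenation of factorisations, reversal with opposite signs and translation of the
  conjugating elements realise products, inverses and conjugates, so that the corresponding
  conditions on the pseudonorm can be read off from the costs.\<close>

definition FR_factorisations :: "'a pgroup \<Rightarrow> (('a \<times> real) list \<times> 'a \<times> real \<times> bool) list set" where
  "FR_factorisations G = {L. \<forall>(h, g, r, s) \<in> set L. h \<in> carrier (FR_group G) \<and> g \<in> carrier G}"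

definition FR_cost :: "'a pgroup \<Rightarrow> (('a \<times> real) list \<times> 'a \<times> real \<times> bool) list \<Rightarrow> real" where
  "FR_cost G L = (\<Sum>(h, g, r, s)\<leftarrow>L. \<bar>r\<bar> * gnorm G g)"

context
  fixes G :: "'a pgroup"
begin

interpretation R: group "FR_group G" by (rule group_FR_group)

definition FR_factor :: "('a \<times> real) list \<times> 'a \<times> real \<times> bool \<Rightarrow> ('a \<times> real) list" where
  "FR_factor = (\<lambda>(h, g, r, s). h \<otimes>\<^bsub>FR_group G\<^esub> (if s then gbar g r else inv\<^bsub>FR_group G\<^esub> (gbar g r))
                              \<otimes>\<^bsub>FR_group G\<^esub> inv\<^bsub>FR_group G\<^esub> h)"

lemma FR_conj_prod_simps [simp]:
  "FR_conj_prod G [] = \<one>\<^bsub>FR_group G\<^esub>"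
  "FR_conj_prod G (a # L) = FR_factor a \<otimes>\<^bsub>FR_group G\<^esub> FR_conj_prod G L"
  by (simp_all add: FR_conj_prod_def FR_factor_def)

lemma FR_factorisations_simps [simp]:
  "[] \<in> FR_factorisations G"
  "(h, g, r, s) # L \<in> FR_factorisations G \<longleftrightarrow> h \<in> carrier (FR_group G) \<and> g \<in> carrier G \<and> L \<in> FR_factorisations G"
  "L @ L' \<in> FR_factorisations G \<longleftrightarrow> L \<in> FR_factorisations G \<and> L' \<in> FR_factorisations G"
  by (simp_all add: FR_factorisations_def ball_Un)

lemma FR_cost_simps [simp]:
  "FR_cost G [] = 0"
  "FR_cost G ((h, g, r, s) # L) = \<bar>r\<bar> * gnorm G g + FR_cost G L"
  "FR_cost G (L @ L') = FR_cost G L + FR_cost G L'"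
  by (simp_all add: FR_cost_def)

lemma FR_factor_closed [simp]:
  "h \<in> carrier (FR_group G) \<Longrightarrow> g \<in> carrier G \<Longrightarrow> FR_factor (h, g, r, s) \<in> carrier (FR_group G)"
  by (simp add: FR_factor_def gbar_closed)

lemma FR_conj_prod_closed [simp]: "L \<in> FR_factorisations G \<Longrightarrow> FR_conj_prod G L \<in> carrier (FR_group G)"
  by (induction L) auto

lemma FR_conj_prod_append:
  "L \<in> FR_factorisations G \<Longrightarrow> L' \<in> FR_factorisations G \<Longrightarrow>
    FR_conj_prod G (L @ L') = FR_conj_prod G L \<otimes>\<^bsub>FR_group G\<^esub> FR_conj_prod G L'"
  by (induction L) (auto simp: R.m_assoc)

lemma FR_conj_prod_conj:
  assumes "k \<in> carrier (FR_group G)" "L \<in> FR_factorisations G"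
  shows "\<exists>L' \<in> FR_factorisations G. FR_cost G L' = FR_cost G L \<and>
    FR_conj_prod G L' = k \<otimes>\<^bsub>FR_group G\<^esub> FR_conj_prod G L \<otimes>\<^bsub>FR_group G\<^esub> inv\<^bsub>FR_group G\<^esub> k"
  using assms(2)
proof (induction L)
  case Nil
  show ?case by (rule bexI [of _ "[]"]) (simp_all add: assms)
next
  case (Cons a L)
  obtain h g r s where a: "a = (h, g, r, s)" by (cases a) auto
  from Cons obtain L' where L': "L' \<in> FR_factorisations G" "FR_cost G L' = FR_cost G L"
    "FR_conj_prod G L' = k \<otimes>\<^bsub>FR_group G\<^esub> FR_conj_prod G L \<otimes>\<^bsub>FR_group G\<^esub> inv\<^bsub>FR_group G\<^esub> k"
    by (auto simp: a)
  have cancel: "inv\<^bsub>FR_group G\<^esub> k \<otimes>\<^bsub>FR_group G\<^esub> (k \<otimes>\<^bsub>FR_group G\<^esub> y) = y"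
    if "y \<in> carrier (FR_group G)" for y
    using that assms(1) by (simp flip: R.m_assoc)
  show ?case
    using L' Cons.prems assms(1)
    by (intro bexI [of _ "(k \<otimes>\<^bsub>FR_group G\<^esub> h, g, r, s) # L'"])
       (auto simp: a FR_factor_def gbar_closed R.m_assoc R.inv_mult_group cancel)
qed

lemma FR_conj_prod_inv:
  assumes "L \<in> FR_factorisations G"
  shows "\<exists>L' \<in> FR_factorisations G. FR_cost G L' = FR_cost G L \<and>
    FR_conj_prod G L' = inv\<^bsub>FR_group G\<^esub> FR_conj_prod G L"
  using assms
proof (induction L)
  case Nil
  show ?case by (rule bexI [of _ "[]"]) simp_all
next
  case (Cons a L)
  obtain h g r s where a: "a = (h, g, r, s)" by (cases a) auto
  from Cons obtain L' where L': "L' \<in> FR_factorisations G" "FR_cost G L' = FR_cost G L"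
    "FR_conj_prod G L' = inv\<^bsub>FR_group G\<^esub> FR_conj_prod G L"
    by (auto simp: a)
  have "FR_factor (h, g, r, \<not> s) = inv\<^bsub>FR_group G\<^esub> FR_factor (h, g, r, s)"
    using Cons.prems by (simp add: a FR_factor_def gbar_closed R.m_assoc R.inv_mult_group)
  then show ?case
    using L' Cons.prems
    by (intro bexI [of _ "L' @ [(h, g, r, \<not> s)]"])
       (auto simp: a FR_conj_prod_append R.inv_mult_group)
qed

lemma FR_conj_prod_surj:
  assumes "x \<in> carrier (FR_group G)"
  obtains L where "L \<in> FR_factorisations G" "FR_conj_prod G L = x"
proof -
  from assms have "\<exists>L \<in> FR_factorisations G. FR_conj_prod G L = x"
  proof (induction rule: FR_induct)
    case one
    show ?case by (rule bexI [of _ "[]"]) simp_all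
  next
    case (mult g r w)
    then obtain L where "L \<in> FR_factorisations G" "FR_conj_prod G L = w" by blast
    with mult show ?case
      by (intro bexI [of _ "(\<one>\<^bsub>FR_group G\<^esub>, g, r, True) # L"]) (auto simp: FR_factor_def gbar_closed)
  qed
  then show ?thesis using that by blast
qed

lemma FR_norm_eq: "FR_norm G x = Inf (FR_cost G ` {L \<in> FR_factorisations G. FR_conj_prod G L = x})"
  unfolding FR_norm_def FR_factorisations_def FR_cost_def image_def by (rule arg_cong [where f = Inf]) auto

lemma FR_norm_greatest:
  assumes "x \<in> carrier (FR_group G)"
    and "\<And>L. L \<in> FR_factorisations G \<Longrightarrow> FR_conj_prod G L = x \<Longrightarrow> c \<le> FR_cost G L"
  shows "c \<le> FR_norm G x"
proof -
  obtain L where "L \<in> FR_factorisations G" "FR_conj_prod G L = x" by (rule FR_conj_prod_surj [OF assms(1)])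
  then show ?thesis
    unfolding FR_norm_eq using assms(2) by (intro cInf_greatest) auto
qed

text \<open>The universal property of the pseudonorm: it dominates every pulled-back conjugation-invariant
  pseudonorm that it dominates on the letters \<open>gbar g r\<close>. Indeed the bound holds for each factor of a
  factorisation by conjugation-invariance, and for products by the triangle inequality.\<close>

lemma FR_norm_hom_le:
  assumes P: "pseudonormed_group P" and f: "f \<in> hom (FR_group G) P" and C: "0 \<le> C"
    and le: "\<And>g r. g \<in> carrier G \<Longrightarrow> gnorm P (f (gbar g r)) \<le> C * (\<bar>r\<bar> * gnorm G g)"
    and x: "x \<in> carrier (FR_group G)"
  shows "gnorm P (f x) \<le> C * FR_norm G x"
proof -
  interpret P: pseudonormed_group P by fact
  interpret f: group_hom "FR_group G" P f by unfold_locales (rule f)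
  have *: "gnorm P (f (FR_conj_prod G L)) \<le> C * FR_cost G L" if "L \<in> FR_factorisations G" for L
    using that
  proof (induction L)
    case (Cons a L)
    obtain h g r s where a: "a = (h, g, r, s)" by (cases a) auto
    with Cons.prems have L: "h \<in> carrier (FR_group G)" "g \<in> carrier G" "L \<in> FR_factorisations G" by auto
    have "gnorm P (f (FR_factor a)) = gnorm P (f (gbar g r))"
      using L by (simp add: a FR_factor_def gbar_closed P.gnorm_conj P.gnorm_inv)
    then show ?case
      using Cons.IH L le [OF L(2), of r] P.gnorm_mult [of "f (FR_factor a)" "f (FR_conj_prod G L)"]
      by (simp add: a algebra_simps)
  qed (simp add: P.gnorm_one)
  \<comment> \<open>Dividing by \<open>C\<close> to reach the infimum requires \<open>C \<noteq> 0\<close>; otherwise a single factorisation suffices.\<close>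
  show ?thesis
  proof (cases "C = 0")
    case True
    obtain L where "L \<in> FR_factorisations G" "FR_conj_prod G L = x" by (rule FR_conj_prod_surj [OF x])
    then show ?thesis using * [of L] True by simp
  next
    case False
    with C * have "gnorm P (f x) / C \<le> FR_norm G x"
      by (intro FR_norm_greatest [OF x]) (auto simp: divide_le_eq mult.commute)
    then show ?thesis using C False by (simp add: divide_le_eq mult.commute)
  qed
qed

context
  assumes G: "pseudonormed_group G"
begin

lemma FR_cost_nonneg:
  assumes "L \<in> FR_factorisations G" shows "0 \<le> FR_cost G L"
  using assms
proof (induction L)
  case (Cons a L)
  then show ?case
    by (cases a) (auto intro!: add_nonneg_nonneg mult_nonneg_nonneg pseudonormed_group.gnorm_nonneg [OF G])
qed simp

lemma FR_norm_le:
  assumes "L \<in> FR_factorisations G" shows "FR_norm G (FR_conj_prod G L) \<le> FR_cost G L"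
  unfolding FR_norm_eq using assms FR_cost_nonneg
  by (intro cInf_lower bdd_belowI [of _ 0]) auto

lemma FR_norm_gbar_le: "g \<in> carrier G \<Longrightarrow> FR_norm G (gbar g r) \<le> \<bar>r\<bar> * gnorm G g"
  using FR_norm_le [of "[(\<one>\<^bsub>FR_group G\<^esub>, g, r, True)]"] by (simp add: FR_factor_def gbar_closed)

lemma pseudonormed_FR: "pseudonormed_group (FR G)"
  unfolding FR_def
proof (rule pseudonormed_with_normI)
  show "group (FR_group G)" by (rule group_FR_group)
  show pos: "0 \<le> FR_norm G x" if "x \<in> carrier (FR_group G)" for x
    using that FR_cost_nonneg by (rule FR_norm_greatest)
  show "FR_norm G \<one>\<^bsub>FR_group G\<^esub> = 0"
    using FR_norm_le [of "[]"] pos [of "\<one>\<^bsub>FR_group G\<^esub>"] by simp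
  fix x assume x: "x \<in> carrier (FR_group G)"
  show "FR_norm G (inv\<^bsub>FR_group G\<^esub> x) \<le> FR_norm G x"
    by (rule FR_norm_greatest [OF x]) (use FR_conj_prod_inv FR_norm_le in metis)
  fix y assume y: "y \<in> carrier (FR_group G)"
  have "FR_norm G (x \<otimes>\<^bsub>FR_group G\<^esub> y) - FR_cost G L' \<le> FR_norm G x"
    if "L' \<in> FR_factorisations G" "FR_conj_prod G L' = y" for L'
  proof (rule FR_norm_greatest [OF x])
    fix L assume "L \<in> FR_factorisations G" "FR_conj_prod G L = x"
    with that show "FR_norm G (x \<otimes>\<^bsub>FR_group G\<^esub> y) - FR_cost G L' \<le> FR_cost G L"
      using FR_norm_le [of "L @ L'"] by (simp add: FR_conj_prod_append)
  qed
  then have "FR_norm G (x \<otimes>\<^bsub>FR_group G\<^esub> y) - FR_norm G x \<le> FR_norm G y"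
    by (intro FR_norm_greatest [OF y]) (simp add: algebra_simps)
  then show "FR_norm G (x \<otimes>\<^bsub>FR_group G\<^esub> y) \<le> FR_norm G x + FR_norm G y" by simp
  show "FR_norm G (x \<otimes>\<^bsub>FR_group G\<^esub> y \<otimes>\<^bsub>FR_group G\<^esub> inv\<^bsub>FR_group G\<^esub> x) \<le> FR_norm G y"
    by (rule FR_norm_greatest [OF y]) (use FR_conj_prod_conj [OF x] FR_norm_le in metis)
qed

end

end


section \<open>Homomorphisms between the groups \<open>F\<^sub>\<real>(G)\<close> and \<open>F(G)\<close>\<close>

lemma carrier_FZ: "carrier (FZ G) = generate (FR_group G) ((\<lambda>g. gbar g 1) ` carrier G)"
proof -
  have "x \<in> generate (FR G) S \<longleftrightarrow> x \<in> generate (FR_group G) S" for x S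
  proof
    show "x \<in> generate (FR G) S \<Longrightarrow> x \<in> generate (FR_group G) S"
      by (induction rule: generate.induct) (auto intro: generate.intros)
    show "x \<in> generate (FR_group G) S \<Longrightarrow> x \<in> generate (FR G) S"
      by (induction rule: generate.induct) (use generate.intros [where G = "FR G"] in auto)
  qed
  then show ?thesis by (auto simp: FZ_def)
qed

lemma FZ_simps [simp]:
  "mult (FZ G) = mult (FR_group G)" "one (FZ G) = one (FR_group G)"
  by (simp_all add: FZ_def)

lemma subgroup_FZ: "subgroup (carrier (FZ G)) (FR_group G)"
  unfolding carrier_FZ
  by (intro group.generate_is_subgroup group_FR_group) (auto intro: gbar_closed)

lemma FZ_closed: "x \<in> carrier (FZ G) \<Longrightarrow> x \<in> carrier (FR_group G)"
  using subgroup.subset [OF subgroup_FZ] by blast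

lemma group_FZ: "group (FZ G)"
proof -
  have "subgroup (generate (FR G) ((\<lambda>g. gbar g 1) ` carrier G)) (FR G)"
    by (intro group.generate_is_subgroup group_FR) (auto intro: gbar_closed)
  then show ?thesis
    unfolding FZ_def by (rule subgroup.subgroup_is_group [OF _ group_FR])
qed

lemma hom_FZ: "f \<in> hom (FR_group G) M \<Longrightarrow> f \<in> hom (FZ G) M"
  by (auto simp: hom_def FZ_closed)

text \<open>\<^const>\<open>FZ\<close> is defined by generation inside \<^const>\<open>FR\<close>; for the induction, generation is moved to
  the subgroup itself, where \<open>f\<close> and \<open>f'\<close> are known to preserve inverses.\<close>

lemma FZ_hom_eqI:
  assumes M: "group M" and f: "f \<in> hom (FZ G) M" and f': "f' \<in> hom (FZ G) M"
    and eq: "\<And>g. g \<in> carrier G \<Longrightarrow> f (gbar g 1) = f' (gbar g 1)"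
    and x: "x \<in> carrier (FZ G)"
  shows "f x = f' x"
proof -
  interpret Z: group "FZ G" by (rule group_FZ)
  interpret M: group M by fact
  interpret f: group_hom "FZ G" M f by unfold_locales (rule f)
  interpret f': group_hom "FZ G" M f' by unfold_locales (rule f')
  let ?S = "(\<lambda>g. gbar g 1) ` carrier G"
  have S: "?S \<subseteq> carrier (FZ G)" by (auto simp: carrier_FZ intro: generate.incl)
  have "group (FR G)" by (rule group_FR)
  moreover have "FZ G = (FR G)\<lparr>carrier := carrier (FZ G)\<rparr>"
    by (simp add: FZ_def)
  moreover have "subgroup (carrier (FZ G)) (FR G)"
    by (simp add: FZ_def) (intro group.generate_is_subgroup group_FR, auto intro: gbar_closed)
  ultimately have "generate (FZ G) ?S = generate (FR G) ?S"
    using group.generate_consistent [of "FR G" ?S "carrier (FZ G)"] S by metis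
  then have "x \<in> generate (FZ G) ?S" using x by (simp add: FZ_def)
  then show ?thesis
  proof induction
    case (inv h)
    then have "f (inv\<^bsub>FZ G\<^esub> h) = inv\<^bsub>M\<^esub> f h" "f' (inv\<^bsub>FZ G\<^esub> h) = inv\<^bsub>M\<^esub> f' h"
      using S by (auto intro!: f.hom_inv f'.hom_inv)
    then show ?case using inv eq by auto
  next
    case (eng h1 h2)
    then have "h1 \<in> carrier (FZ G)" "h2 \<in> carrier (FZ G)"
      using Z.generate_in_carrier [OF S] by auto
    then show ?case using eng f.hom_mult [of h1 h2] f'.hom_mult [of h1 h2] by simp
  qed (use f.hom_one f'.hom_one eq in auto)
qed

lemma psi_map_hom': "psi_map G t \<in> hom (FR_group G) (FR_group G)"
  using psi_map_hom [of G t] by simp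

lemma psi_map_closed: "x \<in> carrier (FZ G) \<Longrightarrow> psi_map G t x \<in> carrier (FR_group G)"
  by (intro hom_in_carrier [OF psi_map_hom'] FZ_closed)

context
  fixes G :: "'a pgroup" and H :: "'b pgroup" and \<phi> :: "'a \<Rightarrow> 'b"
  assumes \<phi>: "\<phi> \<in> carrier G \<rightarrow> carrier H"
begin

lemma F_map_hom': "F_map H \<phi> \<in> hom (FR_group G) (FR_group H)"
  using F_map_hom [OF \<phi>] by simp

lemma F_map_psi_map:
  assumes "x \<in> carrier (FR_group G)"
  shows "F_map H \<phi> (psi_map G t x) = psi_map H t (F_map H \<phi> x)"
proof -
  have "(F_map H \<phi> \<circ> psi_map G t) x = (psi_map H t \<circ> F_map H \<phi>) x"
    by (rule FR_hom_eqI [OF group_FR_group hom_compose [OF psi_map_hom' F_map_hom']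
          hom_compose [OF F_map_hom' psi_map_hom'] _ assms])
       (simp add: psi_map_gbar F_map_gbar [OF \<phi>] funcset_mem [OF \<phi>])
  then show ?thesis by simp
qed

lemma F_map_FZ:
  assumes "x \<in> carrier (FZ G)" shows "F_map H \<phi> x \<in> carrier (FZ H)"
proof -
  interpret R: group "FR_group G" by (rule group_FR_group)
  interpret S: group "FR_group H" by (rule group_FR_group)
  interpret F: group_hom "FR_group G" "FR_group H" "F_map H \<phi>"
    by unfold_locales (rule F_map_hom')
  have gens: "(\<lambda>g. gbar g 1) ` carrier G \<subseteq> carrier (FR_group G)"
    by (auto simp: gbar_closed)
  have "F_map H \<phi> ` (\<lambda>g. gbar g 1) ` carrier G \<subseteq> (\<lambda>g. gbar g 1) ` carrier H"
    by (auto simp: F_map_gbar [OF \<phi>] intro!: funcset_mem [OF \<phi>])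
  then have "generate (FR_group H) (F_map H \<phi> ` (\<lambda>g. gbar g 1) ` carrier G) \<subseteq> carrier (FZ H)"
    unfolding carrier_FZ by (rule S.mono_generate)
  moreover have "F_map H \<phi> x \<in> F_map H \<phi> ` generate (FR_group G) ((\<lambda>g. gbar g 1) ` carrier G)"
    using assms by (simp add: carrier_FZ)
  ultimately show ?thesis
    using F.generate_img [OF gens] by auto
qed

end

lemma F_map_id: "x \<in> carrier (FR_group G) \<Longrightarrow> F_map G id x = x"
  by (rule FR_hom_eqI [OF group_FR_group F_map_hom' [of id G G], where f' = "\<lambda>x. x"])
     (simp_all add: F_map_gbar [of id G G] hom_def)

lemma F_map_comp:
  assumes \<phi>: "\<phi> \<in> carrier G \<rightarrow> carrier H" and \<psi>: "\<psi> \<in> carrier H \<rightarrow> carrier K"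
    and x: "x \<in> carrier (FR_group G)"
  shows "F_map K (\<psi> \<circ> \<phi>) x = F_map K \<psi> (F_map H \<phi> x)"
proof -
  have \<psi>\<phi>: "\<psi> \<circ> \<phi> \<in> carrier G \<rightarrow> carrier K" using \<phi> \<psi> by auto
  have "F_map K (\<psi> \<circ> \<phi>) x = (F_map K \<psi> \<circ> F_map H \<phi>) x"
    by (rule FR_hom_eqI [OF group_FR_group [of K] F_map_hom' [OF \<psi>\<phi>]
          hom_compose [OF F_map_hom' [OF \<phi>] F_map_hom' [OF \<psi>]] _ x])
       (simp add: F_map_gbar [OF \<phi>] F_map_gbar [OF \<psi>] F_map_gbar [OF \<psi>\<phi>] funcset_mem [OF \<phi>])
  then show ?thesis by simp
qed

lemma pi_map_F_map:
  assumes "group G" "group H" and \<phi>: "\<phi> \<in> hom G H" and x: "x \<in> carrier (FZ G)"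
  shows "pi_map H (F_map H \<phi> x) = \<phi> (pi_map G x)"
proof -
  have \<phi>': "\<phi> \<in> carrier G \<rightarrow> carrier H" using \<phi> by (simp add: hom_def)
  have "F_map H \<phi> \<in> hom (FZ G) (FZ H)"
    using hom_FZ [OF F_map_hom' [OF \<phi>']] F_map_FZ [OF \<phi>'] by (auto simp: hom_def)
  then have "pi_map H \<circ> F_map H \<phi> \<in> hom (FZ G) H"
    by (rule hom_compose) (rule pi_map_hom [OF \<open>group H\<close>])
  moreover have "\<phi> \<circ> pi_map G \<in> hom (FZ G) H"
    by (rule hom_compose [OF pi_map_hom [OF \<open>group G\<close>] \<phi>])
  ultimately have "(pi_map H \<circ> F_map H \<phi>) x = (\<phi> \<circ> pi_map G) x"
    by (rule FZ_hom_eqI [OF \<open>group H\<close> _ _ _ x])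
       (simp add: F_map_gbar [OF \<phi>'] pi_map_gbar assms funcset_mem [OF \<phi>'])
  then show ?thesis by simp
qed

lemma lipschitz_hom_F_map:
  assumes H: "pseudonormed_group H" and \<phi>: "lipschitz_hom G H \<phi>"
  shows "lipschitz_hom (FR G) (FR H) (F_map H \<phi>)"
proof -
  obtain C where C: "0 \<le> C" "\<And>x. x \<in> carrier G \<Longrightarrow> gnorm H (\<phi> x) \<le> C * gnorm G x"
    and hom: "\<phi> \<in> hom G H"
    using \<phi> by (auto simp: lipschitz_hom_def)
  have \<phi>': "\<phi> \<in> carrier G \<rightarrow> carrier H" using hom by (simp add: hom_def)
  have gbar: "gnorm (FR H) (F_map H \<phi> (gbar g r)) \<le> C * (\<bar>r\<bar> * gnorm G g)" if g: "g \<in> carrier G" for g r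
  proof -
    have "FR_norm H (gbar (\<phi> g) r) \<le> \<bar>r\<bar> * gnorm H (\<phi> g)"
      by (rule FR_norm_gbar_le [OF H funcset_mem [OF \<phi>' g]])
    also have "\<dots> \<le> \<bar>r\<bar> * (C * gnorm G g)" by (intro mult_left_mono C(2) g) simp
    finally show ?thesis by (simp add: F_map_gbar [OF \<phi>' g] mult.left_commute)
  qed
  have "gnorm (FR H) (F_map H \<phi> x) \<le> C * FR_norm G x" if "x \<in> carrier (FR_group G)" for x
    by (rule FR_norm_hom_le [OF pseudonormed_FR [OF H] _ C(1) gbar that]) (simp add: F_map_hom' [OF \<phi>'])
  with C(1) F_map_hom' [OF \<phi>'] show ?thesis
    by (auto simp: lipschitz_hom_def)
qed


section \<open>Cauchy functions on a scaling set\<close>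

text \<open>The filter of limits along \<open>T\<close>; its nontriviality is the unboundedness of \<open>T\<close>, and it is
  what makes these limits unique.\<close>

lemma scaling_filter_nontrivial:
  assumes "scaling_set T" shows "inf at_top (principal T) \<noteq> (bot :: real filter)"
proof
  assume "inf at_top (principal T) = (bot :: real filter)"
  then have "eventually (\<lambda>t. t \<notin> T) at_top"
    by (simp add: trivial_limit_def eventually_inf_principal)
  then obtain N where N: "\<And>t. N \<le> t \<Longrightarrow> t \<notin> T" by (auto simp: eventually_at_top_linorder)
  then have "bdd_above T" by (intro bdd_aboveI [of _ N]) (meson linear)
  with assms show False by (simp add: scaling_set_def)
qed

lemma eventually_scaling_filterI:
  "(\<And>t. t \<in> T \<Longrightarrow> N \<le> t \<Longrightarrow> P t) \<Longrightarrow> eventually P (inf at_top (principal T))" for N :: real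
  unfolding eventually_inf_principal eventually_at_top_linorder by blast

lemma Cauchy_alongD:
  assumes "Cauchy_along P T f" "0 < \<epsilon>"
  obtains N where "\<And>t t'. t \<in> T \<Longrightarrow> t' \<in> T \<Longrightarrow> N \<le> t \<Longrightarrow> N \<le> t' \<Longrightarrow> gdist P (f t) (f t') < \<epsilon>"
  using assms unfolding Cauchy_along_def by blast

lemma Cauchy_along_le:
  assumes "Cauchy_along P T f" "0 \<le> C"
    and le: "\<And>t t'. t \<in> T \<Longrightarrow> t' \<in> T \<Longrightarrow> gdist Q (g t) (g t') \<le> C * gdist P (f t) (f t')"
  shows "Cauchy_along Q T g"
  unfolding Cauchy_along_def
proof (intro allI impI)
  fix \<epsilon> :: real assume "0 < \<epsilon>"
  \<comment> \<open>Adding 1 avoids a division by zero when \<open>C = 0\<close>.\<close>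
  then have "0 < \<epsilon> / (C + 1)" using assms(2) by simp
  with assms(1) obtain N where N: "\<And>t t'. t \<in> T \<Longrightarrow> t' \<in> T \<Longrightarrow> N \<le> t \<Longrightarrow> N \<le> t' \<Longrightarrow>
      gdist P (f t) (f t') < \<epsilon> / (C + 1)"
    by (rule Cauchy_alongD) blast
  have "gdist Q (g t) (g t') < \<epsilon>" if t: "t \<in> T" "t' \<in> T" "N \<le> t" "N \<le> t'" for t t'
  proof -
    have "C * gdist P (f t) (f t') \<le> C * (\<epsilon> / (C + 1))"
      using N [OF t] assms(2) by (intro mult_left_mono) auto
    also have "\<dots> < \<epsilon>" using \<open>0 < \<epsilon>\<close> assms(2) by (simp add: field_simps)
    finally show ?thesis using le [OF t(1,2)] by simp
  qed
  then show "\<exists>N. \<forall>t\<in>T. \<forall>t'\<in>T. N \<le> t \<longrightarrow> N \<le> t' \<longrightarrow> gdist Q (g t) (g t') < \<epsilon>" by blast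
qed

lemma Cauchy_along_cong:
  assumes "\<And>t. t \<in> T \<Longrightarrow> f t = g t" shows "Cauchy_along P T f \<longleftrightarrow> Cauchy_along P T g"
  unfolding Cauchy_along_def using assms by (simp cong: ball_cong)

context pseudonormed_group
begin

lemma Cauchy_along_one: "Cauchy_along G T (\<lambda>_. \<one>)"
  by (auto simp: Cauchy_along_def gdist_def gnorm_one)

lemma Cauchy_along_inv:
  assumes "Cauchy_along G T f" "f \<in> T \<rightarrow> carrier G"
  shows "Cauchy_along G T (\<lambda>t. inv f t)"
  by (rule Cauchy_along_le [OF assms(1), of 1]) (use assms(2) gdist_inv_le in auto)

lemma Cauchy_along_mult:
  assumes "Cauchy_along G T f" "f \<in> T \<rightarrow> carrier G" "Cauchy_along G T g" "g \<in> T \<rightarrow> carrier G"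
  shows "Cauchy_along G T (\<lambda>t. f t \<otimes> g t)"
  unfolding Cauchy_along_def
proof (intro allI impI)
  fix \<epsilon> :: real assume "0 < \<epsilon>"
  then have \<epsilon>: "0 < \<epsilon> / 2" by simp
  obtain M where M: "\<And>t t'. t \<in> T \<Longrightarrow> t' \<in> T \<Longrightarrow> M \<le> t \<Longrightarrow> M \<le> t' \<Longrightarrow> gdist G (f t) (f t') < \<epsilon> / 2"
    using assms(1) \<epsilon> by (rule Cauchy_alongD) blast
  obtain N where N: "\<And>t t'. t \<in> T \<Longrightarrow> t' \<in> T \<Longrightarrow> N \<le> t \<Longrightarrow> N \<le> t' \<Longrightarrow> gdist G (g t) (g t') < \<epsilon> / 2"
    using assms(3) \<epsilon> by (rule Cauchy_alongD) blast
  have "gdist G (f t \<otimes> g t) (f t' \<otimes> g t') < \<epsilon>"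
    if t: "t \<in> T" "t' \<in> T" "max M N \<le> t" "max M N \<le> t'" for t t'
    using gdist_mult_le [of "f t" "g t" "f t'" "g t'"] M [of t t'] N [of t t'] t assms(2,4)
    by (auto simp: Pi_iff)
  then show "\<exists>N. \<forall>t\<in>T. \<forall>t'\<in>T. N \<le> t \<longrightarrow> N \<le> t' \<longrightarrow> gdist G (f t \<otimes> g t) (f t' \<otimes> g t') < \<epsilon>" by blast
qed

text \<open>The pseudonorm is 1-Lipschitz for its own pseudometric, so it turns the Cauchy function \<open>f\<close>
  into a Cauchy filter of real numbers.\<close>

lemma Cauchy_along_norm_tendsto:
  assumes T: "scaling_set T" and f: "Cauchy_along G T f" "f \<in> T \<rightarrow> carrier G"
  shows "((\<lambda>t. gnorm G (f t)) \<longlongrightarrow> Lim (inf at_top (principal T)) (\<lambda>t. gnorm G (f t)))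
           (inf at_top (principal T))"
proof -
  let ?F = "inf at_top (principal T) :: real filter" and ?n = "\<lambda>t. gnorm G (f t)"
  have "cauchy_filter (filtermap ?n ?F)"
    unfolding cauchy_filter_metric_filtermap
  proof (intro allI impI)
    fix e :: real assume "0 < e"
    with f(1) obtain N where N: "\<And>t t'. t \<in> T \<Longrightarrow> t' \<in> T \<Longrightarrow> N \<le> t \<Longrightarrow> N \<le> t' \<Longrightarrow> gdist G (f t) (f t') < e"
      by (rule Cauchy_alongD) blast
    have "dist (?n t) (?n t') < e" if t: "t \<in> T \<and> N \<le> t" "t' \<in> T \<and> N \<le> t'" for t t'
      using gnorm_diff_le [of "f t" "f t'"] N [of t t'] t f(2) by (auto simp: dist_real_def Pi_iff)
    then show "\<exists>P. eventually P ?F \<and> (\<forall>t t'. P t \<and> P t' \<longrightarrow> dist (?n t) (?n t') < e)"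
      by (intro exI [of _ "\<lambda>t. t \<in> T \<and> N \<le> t"]) (auto intro: eventually_scaling_filterI)
  qed
  moreover have "complete (UNIV :: real set)"
    by (auto simp: complete_def Cauchy_convergent_iff convergent_def)
  moreover have "filtermap ?n ?F \<noteq> bot"
    using scaling_filter_nontrivial [OF T] by (simp add: filtermap_bot_iff)
  ultimately obtain c where "filtermap ?n ?F \<le> nhds c"
    using cauchy_filter_complete_converges [of "filtermap ?n ?F" UNIV] by auto
  then have "(?n \<longlongrightarrow> c) ?F" by (simp add: filterlim_def)
  then show ?thesis
    using tendsto_Lim [OF scaling_filter_nontrivial [OF T]] by metis
qed

end


section \<open>The directional asymptotic cone\<close>

lemma carrier_D_grp: "w \<in> carrier (D_grp T G) \<longleftrightarrow>
    w \<in> T \<rightarrow>\<^sub>E carrier (FZ G) \<and> Cauchy_along (FR G) T (\<lambda>t. psi_map G (1 / t) (w t))"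
  by (simp add: D_grp_def)

lemma mult_D_grp: "v \<otimes>\<^bsub>D_grp T G\<^esub> w = (\<lambda>t\<in>T. v t \<otimes>\<^bsub>FR_group G\<^esub> w t)"
  by (simp add: D_grp_def)

lemma D_grp_rescale_hom:
  assumes "t \<in> T" shows "(\<lambda>w. psi_map G (1 / t) (w t)) \<in> hom (D_grp T G) (FR_group G)"
proof (rule homI)
  fix v w assume "v \<in> carrier (D_grp T G)" "w \<in> carrier (D_grp T G)"
  then have "v t \<in> carrier (FR_group G)" "w t \<in> carrier (FR_group G)"
    using assms by (auto simp: carrier_D_grp intro: FZ_closed)
  then show "psi_map G (1 / t) ((v \<otimes>\<^bsub>D_grp T G\<^esub> w) t)
      = psi_map G (1 / t) (v t) \<otimes>\<^bsub>FR_group G\<^esub> psi_map G (1 / t) (w t)"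
    using assms by (simp add: mult_D_grp hom_mult [OF psi_map_hom'])
qed (use assms in \<open>auto simp: carrier_D_grp intro: psi_map_closed\<close>)

context
  fixes T :: "real set" and G :: "'a pgroup"
  assumes T: "scaling_set T" and G: "pseudonormed_group G"
begin

interpretation G: pseudonormed_group G by (rule G)
interpretation FR: pseudonormed_group "FR G" by (rule pseudonormed_FR [OF G])
interpretation Z: group "FZ G" by (rule group_FZ)

lemma subgroup_D_grp: "subgroup (carrier (D_grp T G)) (product_group T (\<lambda>_. FZ G))"
proof (rule group.subgroupI)
  show "group (product_group T (\<lambda>_. FZ G))" by simp
  show "carrier (D_grp T G) \<subseteq> carrier (product_group T (\<lambda>_. FZ G))"
    by (auto simp: carrier_D_grp)
  have psi: "group_hom (FZ G) (FR G) (psi_map G t)" for t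
    by unfold_locales (simp add: hom_FZ psi_map_hom')
  have "Cauchy_along (FR G) T (\<lambda>t. psi_map G (1 / t) \<one>\<^bsub>FZ G\<^esub>)"
    using FR.Cauchy_along_one group_hom.hom_one [OF psi] by simp
  then have "(\<lambda>t\<in>T. \<one>\<^bsub>FZ G\<^esub>) \<in> carrier (D_grp T G)"
    unfolding carrier_D_grp
    by (auto simp: PiE_iff simp flip: FZ_simps cong: Cauchy_along_cong)
  then show "carrier (D_grp T G) \<noteq> {}" by blast
  fix v assume v: "v \<in> carrier (D_grp T G)"
  then have v': "v \<in> T \<rightarrow>\<^sub>E carrier (FZ G)" by (simp add: carrier_D_grp)
  have "Cauchy_along (FR G) T (\<lambda>t. inv\<^bsub>FR G\<^esub> psi_map G (1 / t) (v t))"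
    using v by (intro FR.Cauchy_along_inv) (auto simp: carrier_D_grp intro: psi_map_closed)
  then have "Cauchy_along (FR G) T (\<lambda>t. psi_map G (1 / t) (inv\<^bsub>FZ G\<^esub> v t))"
    using v' group_hom.hom_inv [OF psi] by (auto simp: PiE_iff cong: Cauchy_along_cong)
  then show "inv\<^bsub>product_group T (\<lambda>_. FZ G)\<^esub> v \<in> carrier (D_grp T G)"
    using v' by (auto simp: carrier_D_grp PiE_iff cong: Cauchy_along_cong)
  fix w assume w: "w \<in> carrier (D_grp T G)"
  then have w': "w \<in> T \<rightarrow>\<^sub>E carrier (FZ G)" by (simp add: carrier_D_grp)
  have "Cauchy_along (FR G) T (\<lambda>t. psi_map G (1 / t) (v t) \<otimes>\<^bsub>FR G\<^esub> psi_map G (1 / t) (w t))"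
    using v w by (intro FR.Cauchy_along_mult) (auto simp: carrier_D_grp intro: psi_map_closed)
  then have "Cauchy_along (FR G) T (\<lambda>t. psi_map G (1 / t) (v t \<otimes>\<^bsub>FZ G\<^esub> w t))"
    using v' w' group_hom.hom_mult [OF psi] by (auto simp: PiE_iff cong: Cauchy_along_cong)
  moreover have "v t \<otimes>\<^bsub>FZ G\<^esub> w t \<in> carrier (FZ G)" if "t \<in> T" for t
    by (rule Z.m_closed) (use v' w' that in auto)
  ultimately show "v \<otimes>\<^bsub>product_group T (\<lambda>_. FZ G)\<^esub> w \<in> carrier (D_grp T G)"
    by (auto simp: carrier_D_grp cong: Cauchy_along_cong)
qed

lemma D_norm_tendsto:
  assumes "w \<in> carrier (D_grp T G)"
  shows "((\<lambda>t. FR_norm G (psi_map G (1 / t) (w t))) \<longlongrightarrow> gnorm (D_grp T G) w)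
           (inf at_top (principal T))"
proof -
  have "(\<lambda>t. psi_map G (1 / t) (w t)) \<in> T \<rightarrow> carrier (FR G)"
    using assms by (auto simp: carrier_D_grp intro: psi_map_closed)
  then show ?thesis
    using FR.Cauchy_along_norm_tendsto [OF T, of "\<lambda>t. psi_map G (1 / t) (w t)"] assms
    by (simp add: carrier_D_grp D_grp_def D_norm_def)
qed

lemma pseudonormed_D_grp: "pseudonormed_group (D_grp T G)"
proof -
  let ?M = "(product_group T (\<lambda>_. FZ G))\<lparr>carrier := carrier (D_grp T G)\<rparr>"
  have D: "D_grp T G = with_norm ?M (D_norm T G)" by (simp add: D_grp_def)
  have "pseudonormed_group (with_norm ?M (D_norm T G))"
  proof (rule pseudonormed_limit [OF pseudonormed_FR [OF G] _ scaling_filter_nontrivial [OF T]])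
    show "group ?M"
      by (rule subgroup.subgroup_is_group [OF subgroup_D_grp]) simp
    show "(\<lambda>w. psi_map G (1 / t) (w t)) \<in> hom ?M (FR G)" if "t \<in> T" for t
      using D_grp_rescale_hom [OF that, of G] by (subst (asm) D) simp
    show "eventually (\<lambda>t. t \<in> T) (inf at_top (principal T))"
      by (rule eventually_scaling_filterI)
    show "((\<lambda>t. gnorm (FR G) (psi_map G (1 / t) (w t))) \<longlongrightarrow> D_norm T G w) (inf at_top (principal T))"
      if "w \<in> carrier ?M" for w
      using D_norm_tendsto [of w] that by (simp add: D_grp_def)
  qed
  then show ?thesis by (simp flip: D)
qed

lemma pi_star_hom: "pi_star T G \<in> hom (D_grp T G) (product_group T (\<lambda>_. G))"
proof (rule homI)
  have pi: "pi_map G \<in> hom (FZ G) G" by (rule pi_map_hom) (rule G.group_axioms)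
  fix v assume v: "v \<in> carrier (D_grp T G)"
  then show "pi_star T G v \<in> carrier (product_group T (\<lambda>_. G))"
    by (auto simp: pi_star_def compose_def carrier_D_grp intro!: hom_in_carrier [OF pi])
  fix w assume w: "w \<in> carrier (D_grp T G)"
  have "pi_map G (v t \<otimes>\<^bsub>FR_group G\<^esub> w t) = pi_map G (v t) \<otimes>\<^bsub>G\<^esub> pi_map G (w t)" if "t \<in> T" for t
    using hom_mult [OF pi, of "v t" "w t"] v w that by (auto simp: carrier_D_grp)
  then show "pi_star T G (v \<otimes>\<^bsub>D_grp T G\<^esub> w)
      = pi_star T G v \<otimes>\<^bsub>product_group T (\<lambda>_. G)\<^esub> pi_star T G w"
    by (auto simp: pi_star_def compose_def mult_D_grp)
qed

lemma image_pseudonorm_pi_star: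
  "image_pseudonorm (D_grp T G) (product_group T (\<lambda>_. G)) (pi_star T G)"
proof -
  interpret D: pseudonormed_group "D_grp T G" by (rule pseudonormed_D_grp)
  interpret M: group "product_group T (\<lambda>_. G)" by (simp add: G.group_axioms)
  show ?thesis by unfold_locales (rule pi_star_hom)
qed

lemma C_grp_eq:
  "C_grp T G = with_norm ((product_group T (\<lambda>_. G))\<lparr>carrier := pi_star T G ` carrier (D_grp T G)\<rparr>)
     (image_pseudonorm.image_norm (D_grp T G) (pi_star T G))"
  unfolding C_grp_def
  by (rule arg_cong2 [where f = with_norm])
     (auto simp: C_norm_def image_pseudonorm.image_norm_def [OF image_pseudonorm_pi_star])

lemma pseudonormed_C_grp: "pseudonormed_group (C_grp T G)"
  unfolding C_grp_eq by (rule image_pseudonorm.pseudonormed_image [OF image_pseudonorm_pi_star])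

lemma lipschitz_hom_pi_star: "lipschitz_hom (D_grp T G) (C_grp T G) (pi_star T G)"
  unfolding C_grp_eq by (rule image_pseudonorm.lipschitz_hom_image [OF image_pseudonorm_pi_star])

end

lemma carrier_C_grp: "carrier (C_grp T G) = pi_star T G ` carrier (D_grp T G)"
  by (simp add: C_grp_def)

lemma carrier_C_grp_extensional: "g \<in> carrier (C_grp T G) \<Longrightarrow> g \<in> extensional T"
  by (auto simp: carrier_C_grp pi_star_def)

context
  fixes T :: "real set" and G :: "'a pgroup" and H :: "'b pgroup" and \<phi> :: "'a \<Rightarrow> 'b"
  assumes T: "scaling_set T" and G: "pseudonormed_group G" and H: "pseudonormed_group H"
    and \<phi>: "lipschitz_hom G H \<phi>"
begin

text \<open>Naturality of \<open>\<pi>\<^sub>*\<close>, which is also the reason why \<open>C_map\<close> is Lipschitz: it exhibits \<open>C_map\<close> as the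
  map induced by \<open>D_map\<close> on images.\<close>

lemma pi_star_D_map:
  assumes "w \<in> carrier (D_grp T G)"
  shows "pi_star T H (D_map T H \<phi> w) = C_map T \<phi> (pi_star T G w)"
proof -
  have "pi_map H (F_map H \<phi> (w t)) = \<phi> (pi_map G (w t))" if "t \<in> T" for t
    using assms that \<phi> G H
    by (intro pi_map_F_map) (auto simp: carrier_D_grp lipschitz_hom_def pseudonormed_group_def)
  then show ?thesis by (auto simp: pi_star_def D_map_def C_map_def compose_def)
qed

text \<open>As \<open>F(\<phi>)\<close> commutes with rescaling, its Lipschitz bound applies at every time \<open>t\<close> to the rescaled
  words. There it controls both distances, which preserves the Cauchy condition, and pseudonorms,
  which gives the bound in the limit.\<close>

lemma lipschitz_hom_D_map: "lipschitz_hom (D_grp T G) (D_grp T H) (D_map T H \<phi>)"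
proof -
  interpret FG: group "FR_group G" by (rule group_FR_group)
  interpret FH: group "FR_group H" by (rule group_FR_group)
  have \<phi>': "\<phi> \<in> carrier G \<rightarrow> carrier H" using \<phi> by (simp add: lipschitz_hom_def hom_def)
  note F = F_map_hom' [OF \<phi>']
  interpret F: group_hom "FR_group G" "FR_group H" "F_map H \<phi>" by unfold_locales (rule F)
  obtain C where C: "0 \<le> C" "\<And>x. x \<in> carrier (FR_group G) \<Longrightarrow> FR_norm H (F_map H \<phi> x) \<le> C * FR_norm G x"
    using lipschitz_hom_F_map [OF H \<phi>] by (auto simp: lipschitz_hom_def)
  have psi: "psi_map H (1 / t) (D_map T H \<phi> w t) = F_map H \<phi> (psi_map G (1 / t) (w t))"
    if "w \<in> carrier (D_grp T G)" "t \<in> T" for w t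
    using that by (auto simp: D_map_def compose_eq carrier_D_grp F_map_psi_map [OF \<phi>'] FZ_closed PiE_iff)
  have cl: "psi_map G (1 / t) (w t) \<in> carrier (FR_group G)"
    if "w \<in> carrier (D_grp T G)" "t \<in> T" for w t
    using that by (auto simp: carrier_D_grp intro: psi_map_closed)
  have D: "D_map T H \<phi> w \<in> carrier (D_grp T H)" if w: "w \<in> carrier (D_grp T G)" for w
    unfolding carrier_D_grp
  proof
    show "D_map T H \<phi> w \<in> T \<rightarrow>\<^sub>E carrier (FZ H)"
      using w by (auto simp: D_map_def compose_def carrier_D_grp intro!: F_map_FZ [OF \<phi>'])
    have "Cauchy_along (FR G) T (\<lambda>t. psi_map G (1 / t) (w t))" using w by (simp add: carrier_D_grp)
    then show "Cauchy_along (FR H) T (\<lambda>t. psi_map H (1 / t) (D_map T H \<phi> w t))"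
    proof (rule Cauchy_along_le [OF _ C(1)])
      fix t t' assume t: "t \<in> T" "t' \<in> T"
      show "gdist (FR H) (psi_map H (1 / t) (D_map T H \<phi> w t)) (psi_map H (1 / t') (D_map T H \<phi> w t'))
          \<le> C * gdist (FR G) (psi_map G (1 / t) (w t)) (psi_map G (1 / t') (w t'))"
        using C(2) [of "inv\<^bsub>FR_group G\<^esub> psi_map G (1 / t) (w t) \<otimes>\<^bsub>FR_group G\<^esub> psi_map G (1 / t') (w t')"]
        by (simp add: psi [OF w] t gdist_def cl [OF w])
    qed
  qed
  have "D_map T H \<phi> \<in> hom (D_grp T G) (D_grp T H)"
  proof (rule homI [OF D])
    fix v w assume "v \<in> carrier (D_grp T G)" "w \<in> carrier (D_grp T G)"
    then have "F_map H \<phi> (v t \<otimes>\<^bsub>FR_group G\<^esub> w t) = F_map H \<phi> (v t) \<otimes>\<^bsub>FR_group H\<^esub> F_map H \<phi> (w t)"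
      if "t \<in> T" for t
      using that by (intro F.hom_mult) (auto simp: carrier_D_grp intro: FZ_closed)
    then show "D_map T H \<phi> (v \<otimes>\<^bsub>D_grp T G\<^esub> w) = D_map T H \<phi> v \<otimes>\<^bsub>D_grp T H\<^esub> D_map T H \<phi> w"
      by (auto simp: D_map_def compose_def mult_D_grp)
  qed
  moreover have "gnorm (D_grp T H) (D_map T H \<phi> w) \<le> C * gnorm (D_grp T G) w"
    if w: "w \<in> carrier (D_grp T G)" for w
    by (rule tendsto_le [OF scaling_filter_nontrivial [OF T]
          tendsto_mult_left [OF D_norm_tendsto [OF T G w]] D_norm_tendsto [OF T H D [OF w]]])
       (rule eventually_scaling_filterI, simp add: psi [OF w] C(2) cl [OF w])
  ultimately show ?thesis
    using C(1) by (auto simp: lipschitz_hom_def)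
qed

lemma lipschitz_hom_C_map: "lipschitz_hom (C_grp T G) (C_grp T H) (C_map T \<phi>)"
  unfolding C_grp_eq [OF T G] C_grp_eq [OF T H]
  by (rule lipschitz_hom_between_images [OF image_pseudonorm_pi_star [OF T G]
        image_pseudonorm_pi_star [OF T H] lipschitz_hom_D_map])
     (simp add: pi_star_D_map)

end

lemma C_map_id: "g \<in> extensional T \<Longrightarrow> C_map T id g = g"
  by (auto simp: C_map_def compose_def extensional_def)

lemma C_map_comp: "C_map T (\<psi> \<circ> \<phi>) g = C_map T \<psi> (C_map T \<phi> g)"
  by (auto simp: C_map_def compose_def)

lemma D_map_id:
  assumes "w \<in> carrier (D_grp T G)" shows "D_map T G id w = w"
proof
  fix t show "D_map T G id w t = w t"
    using assms F_map_id [OF FZ_closed, of "w t" G]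
    by (cases "t \<in> T") (auto simp: D_map_def compose_def carrier_D_grp)
qed

lemma D_map_comp:
  assumes "\<phi> \<in> carrier G \<rightarrow> carrier H" "\<psi> \<in> carrier H \<rightarrow> carrier K" "w \<in> carrier (D_grp T G)"
  shows "D_map T K (\<psi> \<circ> \<phi>) w = D_map T K \<psi> (D_map T H \<phi> w)"
proof -
  have "F_map K (\<psi> \<circ> \<phi>) (w t) = F_map K \<psi> (F_map H \<phi> (w t))" if "t \<in> T" for t
    using assms that by (intro F_map_comp FZ_closed) (auto simp: carrier_D_grp)
  then show ?thesis by (auto simp: D_map_def compose_def)
qed

lemma D_hat_map_cls:
  assumes "scaling_set T" "pseudonormed_group G" "pseudonormed_group H" "lipschitz_hom G H \<phi>"
    and "w \<in> carrier (D_grp T G)"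
  shows "D_hat_map T H \<phi> (cls (D_grp T G) w) = cls (D_grp T H) (D_map T H \<phi> w)"
  unfolding D_hat_map_def
  by (intro quot_map_cls pseudonormed_D_grp lipschitz_hom_D_map assms)

lemma C_hat_map_cls:
  assumes "scaling_set T" "pseudonormed_group G" "pseudonormed_group H" "lipschitz_hom G H \<phi>"
    and "g \<in> carrier (C_grp T G)"
  shows "C_hat_map T H \<phi> (cls (C_grp T G) g) = cls (C_grp T H) (C_map T \<phi> g)"
  unfolding C_hat_map_def
  by (intro quot_map_cls pseudonormed_C_grp lipschitz_hom_C_map assms)

lemma pi_hat_cls:
  assumes "scaling_set T" "pseudonormed_group G" "w \<in> carrier (D_grp T G)"
  shows "pi_hat T G (cls (D_grp T G) w) = cls (C_grp T G) (pi_star T G w)"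
  unfolding pi_hat_def
  by (intro quot_map_cls pseudonormed_D_grp pseudonormed_C_grp lipschitz_hom_pi_star assms)

theorem proposition5p11:
  fixes T :: "real set"
    and G :: "'a pgroup" and H :: "'b pgroup" and K :: "'c pgroup"
    and \<phi> :: "'a \<Rightarrow> 'b" and \<psi> :: "'b \<Rightarrow> 'c"
  assumes T: "scaling_set T"
    and G: "pseudonormed_group G" and H: "pseudonormed_group H" and K: "pseudonormed_group K"
    and \<phi>: "lipschitz_hom G H \<phi>" and \<psi>: "lipschitz_hom H K \<psi>"
  shows
   "pseudonormed_group (C_grp T G) \<and>
    normed_group (C_hat T G) \<and>
    (\<forall>g\<in>carrier (C_grp T G). gnorm (C_hat T G) (cls (C_grp T G) g) = gnorm (C_grp T G) g) \<and>
    lipschitz_hom (C_grp T G) (C_grp T H) (C_map T \<phi>) \<and>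
    lipschitz_hom (C_hat T G) (C_hat T H) (C_hat_map T H \<phi>) \<and>
    (\<forall>g\<in>carrier (C_grp T G). C_hat_map T H \<phi> (cls (C_grp T G) g) = cls (C_grp T H) (C_map T \<phi> g)) \<and>
    (\<forall>g\<in>carrier (C_grp T G). C_map T id g = g) \<and>
    (\<forall>X\<in>carrier (C_hat T G). C_hat_map T G id X = X) \<and>
    (\<forall>g\<in>carrier (C_grp T G). C_map T (\<psi> \<circ> \<phi>) g = C_map T \<psi> (C_map T \<phi> g)) \<and>
    (\<forall>X\<in>carrier (C_hat T G). C_hat_map T K (\<psi> \<circ> \<phi>) X = C_hat_map T K \<psi> (C_hat_map T H \<phi> X)) \<and>
    pseudonormed_group (D_grp T G) \<and>
    normed_group (D_hat T G) \<and>
    (\<forall>w\<in>carrier (D_grp T G). gnorm (D_hat T G) (cls (D_grp T G) w) = gnorm (D_grp T G) w) \<and>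
    lipschitz_hom (D_grp T G) (D_grp T H) (D_map T H \<phi>) \<and>
    lipschitz_hom (D_hat T G) (D_hat T H) (D_hat_map T H \<phi>) \<and>
    (\<forall>w\<in>carrier (D_grp T G). D_hat_map T H \<phi> (cls (D_grp T G) w) = cls (D_grp T H) (D_map T H \<phi> w)) \<and>
    (\<forall>w\<in>carrier (D_grp T G). D_map T G id w = w) \<and>
    (\<forall>X\<in>carrier (D_hat T G). D_hat_map T G id X = X) \<and>
    (\<forall>w\<in>carrier (D_grp T G). D_map T K (\<psi> \<circ> \<phi>) w = D_map T K \<psi> (D_map T H \<phi> w)) \<and>
    (\<forall>X\<in>carrier (D_hat T G). D_hat_map T K (\<psi> \<circ> \<phi>) X = D_hat_map T K \<psi> (D_hat_map T H \<phi> X)) \<and>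
    lipschitz_hom (D_grp T G) (C_grp T G) (pi_star T G) \<and>
    lipschitz_hom (D_hat T G) (C_hat T G) (pi_hat T G) \<and>
    (\<forall>w\<in>carrier (D_grp T G). pi_hat T G (cls (D_grp T G) w) = cls (C_grp T G) (pi_star T G w)) \<and>
    (\<forall>w\<in>carrier (D_grp T G). pi_star T H (D_map T H \<phi> w) = C_map T \<phi> (pi_star T G w)) \<and>
    (\<forall>X\<in>carrier (D_hat T G). pi_hat T H (D_hat_map T H \<phi> X) = C_hat_map T H \<phi> (pi_hat T G X))"
proof -
  have id: "lipschitz_hom G G id" by (auto simp: lipschitz_hom_def hom_def intro!: exI [of _ 1])
  have \<psi>\<phi>: "lipschitz_hom G K (\<psi> \<circ> \<phi>)" by (rule lipschitz_hom_comp [OF \<phi> \<psi>])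
  have funs: "\<phi> \<in> carrier G \<rightarrow> carrier H" "\<psi> \<in> carrier H \<rightarrow> carrier K"
    using \<phi> \<psi> by (auto simp: lipschitz_hom_def hom_def)
  note DG = pseudonormed_D_grp [OF T G] and DH = pseudonormed_D_grp [OF T H]
    and CG = pseudonormed_C_grp [OF T G] and CH = pseudonormed_C_grp [OF T H]
    and D\<phi> = lipschitz_hom_D_map [OF T G H \<phi>] and C\<phi> = lipschitz_hom_C_map [OF T G H \<phi>]
    and \<pi> = lipschitz_hom_pi_star [OF T G]
  have DG': "carrier (D_hat T G) = cls (D_grp T G) ` carrier (D_grp T G)"
    unfolding D_hat_def by (rule pseudonormed_group.carrier_norm_quot [OF DG])
  have CG': "carrier (C_hat T G) = cls (C_grp T G) ` carrier (C_grp T G)"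
    unfolding C_hat_def by (rule pseudonormed_group.carrier_norm_quot [OF CG])
  have D\<phi>_closed: "D_map T H \<phi> w \<in> carrier (D_grp T H)" if "w \<in> carrier (D_grp T G)" for w
    using that hom_in_carrier [OF conjunct1 [OF D\<phi> [unfolded lipschitz_hom_def]]] by blast
  have C\<phi>_closed: "C_map T \<phi> g \<in> carrier (C_grp T H)" if "g \<in> carrier (C_grp T G)" for g
    using that hom_in_carrier [OF conjunct1 [OF C\<phi> [unfolded lipschitz_hom_def]]] by blast
  have \<pi>_closed: "pi_star T G w \<in> carrier (C_grp T G)" if "w \<in> carrier (D_grp T G)" for w
    using that by (simp add: carrier_C_grp)
  note D_cls = D_hat_map_cls [OF T G H \<phi>] D_hat_map_cls [OF T G G id]
    D_hat_map_cls [OF T H K \<psi> D\<phi>_closed] D_hat_map_cls [OF T G K \<psi>\<phi>]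
  note C_cls = C_hat_map_cls [OF T G H \<phi>] C_hat_map_cls [OF T G G id]
    C_hat_map_cls [OF T H K \<psi> C\<phi>_closed] C_hat_map_cls [OF T G K \<psi>\<phi>]
  \<comment> \<open>Functoriality and naturality on the quotients follow from the identities on representatives.\<close>
  show ?thesis
  proof (intro conjI ballI)
    show "pseudonormed_group (D_grp T G)" "pseudonormed_group (C_grp T G)"
      by (rule DG CG)+
    show "normed_group (D_hat T G)" "normed_group (C_hat T G)"
      unfolding D_hat_def C_hat_def
      by (rule pseudonormed_group.normed_group_norm_quot [OF DG]
          pseudonormed_group.normed_group_norm_quot [OF CG])+
    show "lipschitz_hom (D_grp T G) (D_grp T H) (D_map T H \<phi>)"
      "lipschitz_hom (C_grp T G) (C_grp T H) (C_map T \<phi>)"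
      "lipschitz_hom (D_grp T G) (C_grp T G) (pi_star T G)"
      by (rule D\<phi> C\<phi> \<pi>)+
    show "lipschitz_hom (D_hat T G) (D_hat T H) (D_hat_map T H \<phi>)"
      unfolding D_hat_def D_hat_map_def by (rule lipschitz_hom_quot_map [OF DG DH D\<phi>])
    show "lipschitz_hom (C_hat T G) (C_hat T H) (C_hat_map T H \<phi>)"
      unfolding C_hat_def C_hat_map_def by (rule lipschitz_hom_quot_map [OF CG CH C\<phi>])
    show "lipschitz_hom (D_hat T G) (C_hat T G) (pi_hat T G)"
      unfolding D_hat_def C_hat_def pi_hat_def by (rule lipschitz_hom_quot_map [OF DG CG \<pi>])
  next
    fix w assume w: "w \<in> carrier (D_grp T G)"
    show "gnorm (D_hat T G) (cls (D_grp T G) w) = gnorm (D_grp T G) w"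
      unfolding D_hat_def by (rule pseudonormed_group.gnorm_norm_quot [OF DG w])
    show "D_hat_map T H \<phi> (cls (D_grp T G) w) = cls (D_grp T H) (D_map T H \<phi> w)"
      by (rule D_cls(1) [OF w])
    show "D_map T G id w = w" by (rule D_map_id [OF w])
    show "D_map T K (\<psi> \<circ> \<phi>) w = D_map T K \<psi> (D_map T H \<phi> w)"
      by (rule D_map_comp [OF funs w])
    show "pi_hat T G (cls (D_grp T G) w) = cls (C_grp T G) (pi_star T G w)"
      by (rule pi_hat_cls [OF T G w])
    show "pi_star T H (D_map T H \<phi> w) = C_map T \<phi> (pi_star T G w)"
      by (rule pi_star_D_map [OF T G H \<phi> w])
  next
    fix g assume g: "g \<in> carrier (C_grp T G)"
    show "gnorm (C_hat T G) (cls (C_grp T G) g) = gnorm (C_grp T G) g"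
      unfolding C_hat_def by (rule pseudonormed_group.gnorm_norm_quot [OF CG g])
    show "C_hat_map T H \<phi> (cls (C_grp T G) g) = cls (C_grp T H) (C_map T \<phi> g)"
      by (rule C_cls(1) [OF g])
    show "C_map T id g = g" by (rule C_map_id [OF carrier_C_grp_extensional [OF g]])
    show "C_map T (\<psi> \<circ> \<phi>) g = C_map T \<psi> (C_map T \<phi> g)" by (rule C_map_comp)
  next
    fix X assume "X \<in> carrier (D_hat T G)"
    then obtain w where w: "w \<in> carrier (D_grp T G)" and X: "X = cls (D_grp T G) w"
      by (auto simp: DG')
    show "D_hat_map T G id X = X"
      by (simp add: X D_cls w D_map_id [OF w])
    show "D_hat_map T K (\<psi> \<circ> \<phi>) X = D_hat_map T K \<psi> (D_hat_map T H \<phi> X)"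
      by (simp add: X D_cls w D_map_comp [OF funs w])
    show "pi_hat T H (D_hat_map T H \<phi> X) = C_hat_map T H \<phi> (pi_hat T G X)"
      by (simp add: X D_cls C_cls w \<pi>_closed pi_hat_cls [OF T G] pi_hat_cls [OF T H] D\<phi>_closed
          pi_star_D_map [OF T G H \<phi>])
  next
    fix X assume "X \<in> carrier (C_hat T G)"
    then obtain g where g: "g \<in> carrier (C_grp T G)" and X: "X = cls (C_grp T G) g"
      by (auto simp: CG')
    show "C_hat_map T G id X = X"
      by (simp add: X C_cls g C_map_id [OF carrier_C_grp_extensional [OF g]])
    show "C_hat_map T K (\<psi> \<circ> \<phi>) X = C_hat_map T K \<psi> (C_hat_map T H \<phi> X)"
      by (simp add: X C_cls g C_map_comp)
  qed
qed

end
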